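(* Let $k$ be a perfect field of characteristic $p>0$, let $G$ be a finite group with a local action $\rho\colon G\to\operatorname{Aut}_k k[[t]]$, and let $N$ be a normal subgroup of $G$. The action of $G/N$ on the tangent space $T_{D_N}=D_N(k[\varepsilon])=\mathrm{H}^1(N,\Theta)$, induced by the action of $G/N$ on the functor $D_N$, corresponds to the standard action of $G/N$ on $\mathrm{H}^1(N,\Theta)$ in group cohomology, $g_*[\gamma_n]=[\gamma_{g^{-1}ng}^{\,g}]$. The restriction morphism $\mathrm{res}\colon D_G\to D_N^{G/N}$ induces on tangent spaces the map $$\mathrm{res}_{k[\varepsilon]}\colon T_{D_G}\to T_{D_N}^{G/N},$$ which is equal to the restriction morphism $\mathrm{H}^1(G,\Theta)\to\mathrm{H}^1(N,\Theta)^{G/N}$ in group cohomology.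
   Context: $\mathcal C$ is the category of local artinian $W(k)$-algebras with residue field $k$, with local $W(k)$-algebra homomorphisms. Write $\Gamma_A=\operatorname{Aut}_A A[[t]]$. A local $G$-action is an injective homomorphism $\rho\colon G\to\Gamma_k$. A lift of $\rho$ to $A\in\mathcal C$ is a homomorphism $\rho_A\colon G\to\Gamma_A$ reducing to $\rho$ modulo $\mathfrak m_A$; two lifts are equivalent if conjugate by an element of $\ker(\Gamma_A\to\Gamma_k)$. $D_G(A)$ is the set of equivalence classes of lifts of $\rho$ to $A$; $D_N$ is the analogous functor for $\rho|_N$. $G/N$ acts on $D_N$: $g_*[\rho_A]$ is the class of $n\mapsto r_g\rho_A(g^{-1}ng)r_g^{-1}$, with $r_g\in\Gamma_A$ any lift of $\rho(g)$. $D_N^{G/N}$ is the subfunctor of invariants; $\mathrm{res}$ is given by restricting lifts from $G$ to $N$ (its image lies in $D_N^{G/N}$). $\Theta=\operatorname{Der}_k k[[t]]$ with $G$-action $d^g=\rho(g)\,d\,\rho(g)^{-1}$. Let $k[\varepsilon]=k[w]/w^2$. The tangent space of a functor $D$ is $T_D=D(k[\varepsilon])$. $\Theta$ is identified with $\ker(\Gamma_{k[\varepsilon]}\to\Gamma_k)$ by sending $d$ to the automorphism $x\mapsto x+\varepsilon d(\bar x)$, where $\bar x$ is the reduction of $x$ modulo $\varepsilon$. $T_{D_G}$ is identified with $\mathrm{H}^1(G,\Theta)$ by sending the class of a 1-cocycle $(\gamma_g)$ to the class of the lift $g\mapsto\gamma_g\rho(g)$; similarly $T_{D_N}=\mathrm{H}^1(N,\Theta)$.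 *)

theory Defs
  imports "HOL-Algebra.Coset" "HOL-Computational_Algebra.Polynomial"
    "HOL-Computational_Algebra.Formal_Power_Series"
begin

section \<open>The dual numbers\<close>

quotient_type (overloaded) 'a dual_num = "'a::comm_ring_1 poly" / "\<lambda>p q. monom 1 2 dvd (p - q)"
  morphisms rep_dual_num dual_of_poly
proof (rule equivpI)
  show "reflp (\<lambda>p q :: 'a poly. monom 1 2 dvd (p - q))"
    by (rule reflpI) simp
  show "symp (\<lambda>p q :: 'a poly. monom 1 2 dvd (p - q))"
    by (rule sympI) (subst (asm) dvd_minus_iff [symmetric], simp)
  show "transp (\<lambda>p q :: 'a poly. monom 1 2 dvd (p - q))"
    by (rule transpI) (drule (1) dvd_add, simp)
qed

instantiation dual_num :: (comm_ring_1) comm_ring_1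
begin

lift_definition zero_dual_num :: "'a dual_num" is 0 .
lift_definition one_dual_num :: "'a dual_num" is 1 .
lift_definition plus_dual_num :: "'a dual_num \<Rightarrow> 'a dual_num \<Rightarrow> 'a dual_num" is "(+)"
  by (drule (1) dvd_add) (simp add: algebra_simps)
lift_definition uminus_dual_num :: "'a dual_num \<Rightarrow> 'a dual_num" is uminus
  by (subst (asm) dvd_minus_iff [symmetric]) simp
lift_definition minus_dual_num :: "'a dual_num \<Rightarrow> 'a dual_num \<Rightarrow> 'a dual_num" is "(-)"
  by (drule (1) dvd_diff) (simp add: algebra_simps)
lift_definition times_dual_num :: "'a dual_num \<Rightarrow> 'a dual_num \<Rightarrow> 'a dual_num" is "(*)"
proof -
  fix p p' q q' :: "'a poly"
  assume "monom 1 2 dvd (p - p')" "monom 1 2 dvd (q - q')"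
  then have "monom 1 2 dvd ((p - p') * q + p' * (q - q'))"
    by (intro dvd_add dvd_mult dvd_mult2)
  then show "monom 1 2 dvd (p * q - p' * q')"
    by (simp add: algebra_simps)
qed

instance
proof
  show "(0::'a dual_num) \<noteq> 1"
    by transfer (simp add: monom_1_dvd_iff' exI [of _ "0::nat"])
qed (transfer; simp add: algebra_simps)+

end

lift_definition dual_const :: "'a::comm_ring_1 \<Rightarrow> 'a dual_num" is "\<lambda>a. [:a:]" .

lift_definition dual_eps :: "'a::comm_ring_1 dual_num" is "[:0, 1:]" .

text \<open>For \<open>x = a + b\<epsilon>\<close>, \<open>dual_red x = a\<close> (the residue map) and \<open>dual_coeff x = b\<close>.\<close>

lift_definition dual_red :: "'a::comm_ring_1 dual_num \<Rightarrow> 'a" is "\<lambda>p. coeff p 0"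
  by (simp add: monom_1_dvd_iff')

lift_definition dual_coeff :: "'a::comm_ring_1 dual_num \<Rightarrow> 'a" is "\<lambda>p. coeff p 1"
  by (simp add: monom_1_dvd_iff')

lemma dual_num_decomp: "x = dual_const (dual_red x) + dual_eps * dual_const (dual_coeff x)"
  by transfer (auto simp: monom_1_dvd_iff' coeff_pCons numeral_2_eq_2 less_Suc_eq)

lemma dual_eps_square: "dual_eps * dual_eps = 0"
  by transfer (auto simp: monom_1_dvd_iff' coeff_pCons numeral_2_eq_2 less_Suc_eq)

lemma dual_coords [simp]:
  "dual_red (dual_const a + dual_eps * dual_const b) = a"
  "dual_coeff (dual_const a + dual_eps * dual_const b) = b"
  by (transfer; simp)+


section \<open>Automorphisms of power series rings\<close>

definition fps_map :: "('a \<Rightarrow> 'b) \<Rightarrow> 'a fps \<Rightarrow> 'b fps" where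
  "fps_map f x = Abs_fps (\<lambda>n. f (fps_nth x n))"

text \<open>\<open>\<Gamma>\<^sub>A\<close>, the group of \<open>A\<close>-algebra automorphisms of \<open>A[[t]]\<close>. No continuity is imposed.\<close>

definition Gam :: "('a::comm_ring_1 fps \<Rightarrow> 'a fps) monoid" where
  "Gam = \<lparr>carrier = {\<sigma>. bij \<sigma> \<and> (\<forall>x y. \<sigma> (x + y) = \<sigma> x + \<sigma> y) \<and> (\<forall>x y. \<sigma> (x * y) = \<sigma> x * \<sigma> y)
                         \<and> (\<forall>a. \<sigma> (fps_const a) = fps_const a)},
          monoid.mult = (\<circ>), one = id\<rparr>"

definition local_action :: "('g, 'm) monoid_scheme \<Rightarrow> ('g \<Rightarrow> 'k::field fps \<Rightarrow> 'k fps) \<Rightarrow> bool" where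
  "local_action G \<rho> \<longleftrightarrow> \<rho> \<in> hom G Gam \<and> inj_on \<rho> (carrier G)"


section \<open>The deformation functor\<close>

text \<open>
  A local artinian \<open>W(k)\<close>-algebra \<open>A\<close> with residue field \<open>k\<close> is given by the type \<open>'a\<close> together
  with its residue map \<open>\<pi> :: 'a \<Rightarrow> 'k\<close>; the notions below involve \<open>A\<close> only through its ring
  structure and \<open>\<pi>\<close>. For \<open>k\<close> perfect this loses nothing, as \<open>A\<close> then carries exactly one
  \<open>W(k)\<close>-algebra structure compatible with \<open>\<pi>\<close>.
\<close>

text \<open>\<open>\<tau>\<close> is the image of \<open>\<sigma>\<close> under \<open>\<Gamma>\<^sub>A \<rightarrow> \<Gamma>\<^sub>k\<close>; it is unique, as \<open>\<pi>\<close> is surjective.\<close>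

definition reduces_to ::
  "('a::comm_ring_1 \<Rightarrow> 'k::field) \<Rightarrow> ('a fps \<Rightarrow> 'a fps) \<Rightarrow> ('k fps \<Rightarrow> 'k fps) \<Rightarrow> bool" where
  "reduces_to \<pi> \<sigma> \<tau> \<longleftrightarrow> (\<forall>x. fps_map \<pi> (\<sigma> x) = \<tau> (fps_map \<pi> x))"

definition red_kernel :: "('a::comm_ring_1 \<Rightarrow> 'k::field) \<Rightarrow> ('a fps \<Rightarrow> 'a fps) set" where
  "red_kernel \<pi> = {u \<in> carrier Gam. reduces_to \<pi> u id}"

text \<open>
  Maps out of a group are taken to be extensional, so that equality of lifts and of cocycles
  is equality of functions. For \<open>D\<^sub>N\<close> the group is \<open>G\<lparr>carrier := N\<rparr>\<close>; only the values of \<open>\<rho>\<close> on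
  the carrier matter, so \<open>\<rho>\<close> itself plays the role of its restriction to \<open>N\<close>.
\<close>

definition lifts ::
  "('a::comm_ring_1 \<Rightarrow> 'k::field) \<Rightarrow> ('g, 'm) monoid_scheme \<Rightarrow> ('g \<Rightarrow> 'k fps \<Rightarrow> 'k fps)
    \<Rightarrow> ('g \<Rightarrow> 'a fps \<Rightarrow> 'a fps) set" where
  "lifts \<pi> G \<rho> = {\<sigma> \<in> hom G Gam \<inter> extensional (carrier G).
                     \<forall>g\<in>carrier G. reduces_to \<pi> (\<sigma> g) (\<rho> g)}"

definition lift_equiv ::
  "('a::comm_ring_1 \<Rightarrow> 'k::field) \<Rightarrow> ('g, 'm) monoid_scheme \<Rightarrow> ('g \<Rightarrow> 'k fps \<Rightarrow> 'k fps)
    \<Rightarrow> ('g \<Rightarrow> 'a fps \<Rightarrow> 'a fps) rel" where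
  "lift_equiv \<pi> G \<rho> = {(\<sigma>, \<sigma>'). \<sigma> \<in> lifts \<pi> G \<rho> \<and> \<sigma>' \<in> lifts \<pi> G \<rho> \<and>
     (\<exists>u\<in>red_kernel \<pi>. \<forall>g\<in>carrier G. \<sigma>' g = u \<otimes>\<^bsub>Gam\<^esub> \<sigma> g \<otimes>\<^bsub>Gam\<^esub> inv\<^bsub>Gam\<^esub> u)}"

definition lift_class ::
  "('a::comm_ring_1 \<Rightarrow> 'k::field) \<Rightarrow> ('g, 'm) monoid_scheme \<Rightarrow> ('g \<Rightarrow> 'k fps \<Rightarrow> 'k fps)
    \<Rightarrow> ('g \<Rightarrow> 'a fps \<Rightarrow> 'a fps) \<Rightarrow> ('g \<Rightarrow> 'a fps \<Rightarrow> 'a fps) set" where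
  "lift_class \<pi> G \<rho> \<sigma> = lift_equiv \<pi> G \<rho> `` {\<sigma>}"

definition def_functor ::
  "('a::comm_ring_1 \<Rightarrow> 'k::field) \<Rightarrow> ('g, 'm) monoid_scheme \<Rightarrow> ('g \<Rightarrow> 'k fps \<Rightarrow> 'k fps)
    \<Rightarrow> ('g \<Rightarrow> 'a fps \<Rightarrow> 'a fps) set set" where
  "def_functor \<pi> G \<rho> = lifts \<pi> G \<rho> // lift_equiv \<pi> G \<rho>"

definition conj_lift ::
  "('g, 'm) monoid_scheme \<Rightarrow> 'g set \<Rightarrow> 'g \<Rightarrow> ('a::comm_ring_1 fps \<Rightarrow> 'a fps)
    \<Rightarrow> ('g \<Rightarrow> 'a fps \<Rightarrow> 'a fps) \<Rightarrow> 'g \<Rightarrow> 'a fps \<Rightarrow> 'a fps" where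
  "conj_lift G N g r \<sigma> =
     (\<lambda>n\<in>N. r \<otimes>\<^bsub>Gam\<^esub> \<sigma> (inv\<^bsub>G\<^esub> g \<otimes>\<^bsub>G\<^esub> n \<otimes>\<^bsub>G\<^esub> g) \<otimes>\<^bsub>Gam\<^esub> inv\<^bsub>Gam\<^esub> r)"

text \<open>
  Maps defined through representatives, here and below, are written as the union of the resulting
  classes over all choices; this is the class of any single choice as soon as the class does not
  depend on the choice. Below \<open>Q\<close> is a coset, that is, an element of \<open>G Mod N\<close>, and \<open>X\<close> a class
  in \<open>D\<^sub>N(A)\<close>.
\<close>

definition def_action ::
  "('a::comm_ring_1 \<Rightarrow> 'k::field) \<Rightarrow> ('g, 'm) monoid_scheme \<Rightarrow> 'g set \<Rightarrow> ('g \<Rightarrow> 'k fps \<Rightarrow> 'k fps)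
    \<Rightarrow> 'g set \<Rightarrow> ('g \<Rightarrow> 'a fps \<Rightarrow> 'a fps) set \<Rightarrow> ('g \<Rightarrow> 'a fps \<Rightarrow> 'a fps) set" where
  "def_action \<pi> G N \<rho> Q X =
     (\<Union>g\<in>Q. \<Union>r\<in>{r \<in> carrier Gam. reduces_to \<pi> r (\<rho> g)}. \<Union>\<sigma>\<in>X.
        lift_class \<pi> (G\<lparr>carrier := N\<rparr>) \<rho> (conj_lift G N g r \<sigma>))"

definition def_invariants ::
  "('a::comm_ring_1 \<Rightarrow> 'k::field) \<Rightarrow> ('g, 'm) monoid_scheme \<Rightarrow> 'g set \<Rightarrow> ('g \<Rightarrow> 'k fps \<Rightarrow> 'k fps)
    \<Rightarrow> ('g \<Rightarrow> 'a fps \<Rightarrow> 'a fps) set set" where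
  "def_invariants \<pi> G N \<rho> =
     {X \<in> def_functor \<pi> (G\<lparr>carrier := N\<rparr>) \<rho>. \<forall>Q\<in>carrier (G Mod N). def_action \<pi> G N \<rho> Q X = X}"

definition def_res ::
  "('a::comm_ring_1 \<Rightarrow> 'k::field) \<Rightarrow> ('g, 'm) monoid_scheme \<Rightarrow> 'g set \<Rightarrow> ('g \<Rightarrow> 'k fps \<Rightarrow> 'k fps)
    \<Rightarrow> ('g \<Rightarrow> 'a fps \<Rightarrow> 'a fps) set \<Rightarrow> ('g \<Rightarrow> 'a fps \<Rightarrow> 'a fps) set" where
  "def_res \<pi> G N \<rho> X = (\<Union>\<sigma>\<in>X. lift_class \<pi> (G\<lparr>carrier := N\<rparr>) \<rho> (restrict \<sigma> N))"


section \<open>First group cohomology\<close>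

text \<open>\<open>M\<close> is an abelian group, written multiplicatively, on which \<open>G\<close> acts by \<open>a\<close>.\<close>

definition Z1 :: "('g, 'm) monoid_scheme \<Rightarrow> ('a, 'n) monoid_scheme \<Rightarrow> ('g \<Rightarrow> 'a \<Rightarrow> 'a)
    \<Rightarrow> ('g \<Rightarrow> 'a) monoid" where
  "Z1 G M a = \<lparr>carrier = {\<gamma> \<in> carrier G \<rightarrow>\<^sub>E carrier M.
                   \<forall>g\<in>carrier G. \<forall>h\<in>carrier G. \<gamma> (g \<otimes>\<^bsub>G\<^esub> h) = \<gamma> g \<otimes>\<^bsub>M\<^esub> a g (\<gamma> h)},
               monoid.mult = (\<lambda>\<gamma> \<delta>. \<lambda>g\<in>carrier G. \<gamma> g \<otimes>\<^bsub>M\<^esub> \<delta> g),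
               one = (\<lambda>g\<in>carrier G. \<one>\<^bsub>M\<^esub>)\<rparr>"

definition B1 :: "('g, 'm) monoid_scheme \<Rightarrow> ('a, 'n) monoid_scheme \<Rightarrow> ('g \<Rightarrow> 'a \<Rightarrow> 'a)
    \<Rightarrow> ('g \<Rightarrow> 'a) set" where
  "B1 G M a = {\<lambda>g\<in>carrier G. a g m \<otimes>\<^bsub>M\<^esub> inv\<^bsub>M\<^esub> m | m. m \<in> carrier M}"

definition H1 :: "('g, 'm) monoid_scheme \<Rightarrow> ('a, 'n) monoid_scheme \<Rightarrow> ('g \<Rightarrow> 'a \<Rightarrow> 'a)
    \<Rightarrow> ('g \<Rightarrow> 'a) set monoid" where
  "H1 G M a = Z1 G M a Mod B1 G M a"

definition H1_class :: "('g, 'm) monoid_scheme \<Rightarrow> ('a, 'n) monoid_scheme \<Rightarrow> ('g \<Rightarrow> 'a \<Rightarrow> 'a)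
    \<Rightarrow> ('g \<Rightarrow> 'a) \<Rightarrow> ('g \<Rightarrow> 'a) set" where
  "H1_class G M a \<gamma> = B1 G M a #>\<^bsub>Z1 G M a\<^esub> \<gamma>"

definition conj_cocycle :: "('g, 'm) monoid_scheme \<Rightarrow> 'g set \<Rightarrow> ('g \<Rightarrow> 'a \<Rightarrow> 'a)
    \<Rightarrow> 'g \<Rightarrow> ('g \<Rightarrow> 'a) \<Rightarrow> 'g \<Rightarrow> 'a" where
  "conj_cocycle G N a g \<gamma> = (\<lambda>n\<in>N. a g (\<gamma> (inv\<^bsub>G\<^esub> g \<otimes>\<^bsub>G\<^esub> n \<otimes>\<^bsub>G\<^esub> g)))"

definition H1_action :: "('g, 'm) monoid_scheme \<Rightarrow> 'g set \<Rightarrow> ('a, 'n) monoid_scheme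
    \<Rightarrow> ('g \<Rightarrow> 'a \<Rightarrow> 'a) \<Rightarrow> 'g set \<Rightarrow> ('g \<Rightarrow> 'a) set \<Rightarrow> ('g \<Rightarrow> 'a) set" where
  "H1_action G N M a Q c =
     (\<Union>g\<in>Q. \<Union>\<gamma>\<in>c. H1_class (G\<lparr>carrier := N\<rparr>) M a (conj_cocycle G N a g \<gamma>))"

definition H1_invariants :: "('g, 'm) monoid_scheme \<Rightarrow> 'g set \<Rightarrow> ('a, 'n) monoid_scheme
    \<Rightarrow> ('g \<Rightarrow> 'a \<Rightarrow> 'a) \<Rightarrow> ('g \<Rightarrow> 'a) set set" where
  "H1_invariants G N M a =
     {c \<in> carrier (H1 (G\<lparr>carrier := N\<rparr>) M a). \<forall>Q\<in>carrier (G Mod N). H1_action G N M a Q c = c}"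

definition H1_res :: "('g, 'm) monoid_scheme \<Rightarrow> 'g set \<Rightarrow> ('a, 'n) monoid_scheme
    \<Rightarrow> ('g \<Rightarrow> 'a \<Rightarrow> 'a) \<Rightarrow> ('g \<Rightarrow> 'a) set \<Rightarrow> ('g \<Rightarrow> 'a) set" where
  "H1_res G N M a c = (\<Union>\<gamma>\<in>c. H1_class (G\<lparr>carrier := N\<rparr>) M a (restrict \<gamma> N))"


section \<open>Derivations and the tangent space\<close>

definition Der :: "('k::field fps \<Rightarrow> 'k fps) monoid" where
  "Der = \<lparr>carrier = {d. (\<forall>x y. d (x + y) = d x + d y) \<and> (\<forall>c x. d (fps_const c * x) = fps_const c * d x)
                         \<and> (\<forall>x y. d (x * y) = x * d y + d x * y)},
          monoid.mult = (\<lambda>d e x. d x + e x), one = (\<lambda>x. 0)\<rparr>"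

definition der_act :: "('g \<Rightarrow> 'k::field fps \<Rightarrow> 'k fps) \<Rightarrow> 'g \<Rightarrow> ('k fps \<Rightarrow> 'k fps) \<Rightarrow> 'k fps \<Rightarrow> 'k fps"
  where "der_act \<rho> g d = \<rho> g \<circ> d \<circ> inv\<^bsub>Gam\<^esub> (\<rho> g)"

abbreviation tangent_space ::
  "('g, 'm) monoid_scheme \<Rightarrow> ('g \<Rightarrow> 'k::field fps \<Rightarrow> 'k fps)
    \<Rightarrow> ('g \<Rightarrow> 'k dual_num fps \<Rightarrow> 'k dual_num fps) set set" where
  "tangent_space \<equiv> def_functor dual_red"

text \<open>The \<open>k[\<epsilon>]\<close>-linear extension of \<open>\<tau>\<close> to \<open>k[\<epsilon>][[t]] = k[[t]] \<oplus> \<epsilon> k[[t]]\<close>.\<close>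

definition base_change :: "('k::field fps \<Rightarrow> 'k fps) \<Rightarrow> 'k dual_num fps \<Rightarrow> 'k dual_num fps" where
  "base_change \<tau> x = fps_map dual_const (\<tau> (fps_map dual_red x))
                   + fps_const dual_eps * fps_map dual_const (\<tau> (fps_map dual_coeff x))"

definition der_aut :: "('k::field fps \<Rightarrow> 'k fps) \<Rightarrow> 'k dual_num fps \<Rightarrow> 'k dual_num fps" where
  "der_aut d x = x + fps_const dual_eps * fps_map dual_const (d (fps_map dual_red x))"

definition cocycle_lift ::
  "('g, 'm) monoid_scheme \<Rightarrow> ('g \<Rightarrow> 'k::field fps \<Rightarrow> 'k fps) \<Rightarrow> ('g \<Rightarrow> 'k fps \<Rightarrow> 'k fps)
    \<Rightarrow> 'g \<Rightarrow> 'k dual_num fps \<Rightarrow> 'k dual_num fps" where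
  "cocycle_lift G \<rho> \<gamma> = (\<lambda>g\<in>carrier G. der_aut (\<gamma> g) \<otimes>\<^bsub>Gam\<^esub> base_change (\<rho> g))"

definition tangent_of_H1 ::
  "('g, 'm) monoid_scheme \<Rightarrow> ('g \<Rightarrow> 'k::field fps \<Rightarrow> 'k fps) \<Rightarrow> ('g \<Rightarrow> 'k fps \<Rightarrow> 'k fps) set
    \<Rightarrow> ('g \<Rightarrow> 'k dual_num fps \<Rightarrow> 'k dual_num fps) set" where
  "tangent_of_H1 G \<rho> c = (\<Union>\<gamma>\<in>c. lift_class dual_red G \<rho> (cocycle_lift G \<rho> \<gamma>))"

end

theory Submission
  imports Defs
begin

text \<open>
  \<open>d \<mapsto> der_aut d\<close> is an isomorphism of \<open>\<Theta>\<close> onto the kernel of \<open>\<Gamma>\<^bsub>k[\<epsilon>]\<^esub> \<rightarrow> \<Gamma>\<^sub>k\<close>, and \<open>base_change\<close> is a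
  homomorphic section of this reduction, conjugation by which induces the action of \<open>\<Gamma>\<^sub>k\<close> on \<open>\<Theta>\<close>.
  Hence every lift of \<open>\<rho>\<close> to \<open>k[\<epsilon>]\<close> is \<open>g \<mapsto> \<gamma>\<^sub>g \<rho>(g)\<close> for a unique cocycle \<open>\<gamma>\<close>, and lifts are
  equivalent if and only if their cocycles are cohomologous. Taking \<open>base_change (\<rho> g)\<close> for \<open>r\<^sub>g\<close>, the
  lift of \<open>conj_cocycle G N (der_act \<rho>) g \<gamma>\<close> is literally the conjugate by \<open>r\<^sub>g\<close> of the lift of \<open>\<gamma>\<close>, and the lift of a
  restricted cocycle is the restricted lift. So well-definedness of the constructions on \<open>H\<^sup>1\<close>, and
  their compatibility with the identification, follow from the corresponding facts about lifts.
\<close>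

section \<open>Power series over the dual numbers\<close>

lemma dual_red_simps [simp]:
  "dual_red 0 = 0" "dual_red 1 = 1"
  "dual_red (x + y) = dual_red x + dual_red y"
  "dual_red (x * y) = dual_red x * dual_red y"
  "dual_red (dual_const a) = a" "dual_red dual_eps = 0"
  by (transfer; simp add: coeff_mult)+

lemma dual_coeff_simps [simp]:
  "dual_coeff 0 = 0"
  "dual_coeff (x + y) = dual_coeff x + dual_coeff y"
  "dual_coeff (x * y) = dual_red x * dual_coeff y + dual_coeff x * dual_red y"
  "dual_coeff (dual_const a) = 0" "dual_coeff dual_eps = 1"
  by (transfer; simp add: coeff_mult)+

lemma dual_num_eqI: "dual_red x = dual_red y \<Longrightarrow> dual_coeff x = dual_coeff y \<Longrightarrow> x = y"
  by (metis dual_num_decomp)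

lemma fps_map_nth [simp]: "fps_nth (fps_map f x) n = f (fps_nth x n)"
  by (simp add: fps_map_def)

lemma dual_red_sum: "dual_red (sum f A) = (\<Sum>i\<in>A. dual_red (f i))"
  by (induction A rule: infinite_finite_induct) auto

lemma dual_coeff_sum: "dual_coeff (sum f A) = (\<Sum>i\<in>A. dual_coeff (f i))"
  by (induction A rule: infinite_finite_induct) auto

lemma fps_map_dual_red [simp]:
  "fps_map dual_red (x + y) = fps_map dual_red x + fps_map dual_red y"
  "fps_map dual_red (x * y) = fps_map dual_red x * fps_map dual_red y"
  "fps_map dual_red (fps_const a) = fps_const (dual_red a)"
  "fps_map dual_red (fps_map dual_const z) = z"
  by (auto simp: fps_eq_iff fps_mult_nth dual_red_sum)

lemma fps_map_dual_coeff [simp]: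
  "fps_map dual_coeff (x + y) = fps_map dual_coeff x + fps_map dual_coeff y"
  "fps_map dual_coeff (x * y) =
     fps_map dual_red x * fps_map dual_coeff y + fps_map dual_coeff x * fps_map dual_red y"
  "fps_map dual_coeff (fps_const a) = fps_const (dual_coeff a)"
  "fps_map dual_coeff (fps_map dual_const z) = 0"
  by (auto simp: fps_eq_iff fps_mult_nth dual_coeff_sum sum.distrib)

text \<open>Identities between maps of \<open>k[\<epsilon>][[t]]\<close> are checked in two
  coordinates over \<open>k[[t]]\<close>, where \<open>base_change\<close> and
  \<open>der_aut\<close> have explicit formulas and the product rule for \<open>dual_coeff\<close>
  already accounts for \<epsilon>^2 = 0.\<close>

lemma dual_fps_eqI:
  assumes "fps_map dual_red x = fps_map dual_red y" "fps_map dual_coeff x = fps_map dual_coeff y"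
  shows "x = y"
  using assms by (auto simp: fps_eq_iff intro: dual_num_eqI)

lemma base_change_coords [simp]:
  "fps_map dual_red (base_change \<tau> x) = \<tau> (fps_map dual_red x)"
  "fps_map dual_coeff (base_change \<tau> x) = \<tau> (fps_map dual_coeff x)"
  by (simp_all add: base_change_def)

lemma der_aut_coords [simp]:
  "fps_map dual_red (der_aut d x) = fps_map dual_red x"
  "fps_map dual_coeff (der_aut d x) = fps_map dual_coeff x + d (fps_map dual_red x)"
  by (simp_all add: der_aut_def)


section \<open>Automorphisms and derivations\<close>

text \<open>With products associated to the right, an element and its inverse may stand next to each
  other in front of the rest of a word; these rules let the simplifier cancel them there.\<close>

lemma (in group) inv_cancel [simp]:
  assumes "x \<in> carrier G" "y \<in> carrier G"
  shows "inv x \<otimes> (x \<otimes> y) = y" "x \<otimes> (inv x \<otimes> y) = y"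
  using assms by (simp_all flip: m_assoc)

lemma Gam_simps: "\<sigma> \<otimes>\<^bsub>Gam\<^esub> \<tau> = \<sigma> \<circ> \<tau>" "\<one>\<^bsub>Gam\<^esub> = id"
  by (simp_all add: Gam_def)

lemma GamI:
  assumes "\<And>x. \<sigma> (\<sigma>' x) = x" "\<And>x. \<sigma>' (\<sigma> x) = x"
    and "\<And>x y. \<sigma> (x + y) = \<sigma> x + \<sigma> y" "\<And>x y. \<sigma> (x * y) = \<sigma> x * \<sigma> y"
    and "\<And>a. \<sigma> (fps_const a) = fps_const a"
  shows "\<sigma> \<in> carrier Gam"
  using assms by (auto simp: Gam_def intro!: o_bij [of \<sigma>'])

lemma GamD:
  assumes "\<sigma> \<in> carrier Gam"
  shows "bij \<sigma>" "\<sigma> (x + y) = \<sigma> x + \<sigma> y" "\<sigma> (x * y) = \<sigma> x * \<sigma> y" "\<sigma> (fps_const a) = fps_const a"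
    "\<sigma> 0 = 0"
proof -
  show c: "\<sigma> (fps_const a) = fps_const a" for a
    using assms by (simp add: Gam_def)
  show "\<sigma> 0 = 0"
    using c [of 0] by simp
qed (use assms in \<open>auto simp: Gam_def\<close>)

lemma group_Gam: "group Gam"
proof (rule groupI)
  fix \<sigma> :: "'a fps \<Rightarrow> 'a fps" assume \<sigma>: "\<sigma> \<in> carrier Gam"
  let ?i = "inv_into UNIV \<sigma>"
  from \<sigma> have b: "\<sigma> (?i x) = x" "?i (\<sigma> x) = x" for x
    by (simp_all add: GamD(1) bij_is_surj surj_f_inv_f bij_is_inj inv_f_f)
  have "?i \<in> carrier Gam"
    by (rule GamI [of _ \<sigma>]) (use b GamD [OF \<sigma>] in metis)+
  moreover have "?i \<otimes>\<^bsub>Gam\<^esub> \<sigma> = \<one>\<^bsub>Gam\<^esub>"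
    using b by (auto simp: Gam_simps)
  ultimately show "\<exists>\<tau>\<in>carrier Gam. \<tau> \<otimes>\<^bsub>Gam\<^esub> \<sigma> = \<one>\<^bsub>Gam\<^esub>"
    by blast
qed (auto simp: Gam_def bij_comp comp_assoc)

interpretation Gam: group Gam
  by (rule group_Gam)

lemma Gam_inv_apply [simp]:
  assumes "\<sigma> \<in> carrier Gam"
  shows "\<sigma> ((inv\<^bsub>Gam\<^esub> \<sigma>) x) = x" "(inv\<^bsub>Gam\<^esub> \<sigma>) (\<sigma> x) = x"
  using Gam.r_inv [OF assms] Gam.l_inv [OF assms] by (auto simp: Gam_simps fun_eq_iff)

lemma Der_simps: "d \<otimes>\<^bsub>Der\<^esub> e = (\<lambda>x. d x + e x)" "\<one>\<^bsub>Der\<^esub> = (\<lambda>x. 0)"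
  by (simp_all add: Der_def)

lemma DerI:
  assumes "\<And>x y. d (x + y) = d x + d y" "\<And>c x. d (fps_const c * x) = fps_const c * d x"
    and "\<And>x y. d (x * y) = x * d y + d x * y"
  shows "d \<in> carrier Der"
  using assms by (simp add: Der_def)

lemma DerD:
  assumes "d \<in> carrier Der"
  shows "d (x + y) = d x + d y" "d (fps_const c * x) = fps_const c * d x"
    "d (x * y) = x * d y + d x * y" "d (fps_const c) = 0" "d 0 = 0"
proof -
  show l: "d (x + y) = d x + d y" "d (fps_const c * x) = fps_const c * d x"
    "d (x * y) = x * d y + d x * y" for x y c
    using assms by (auto simp: Der_def)
  have "d 1 = 0"
    using l(3) [of 1 1] by (metis add_cancel_right_right mult_1 mult.right_neutral)
  then show "d (fps_const c) = 0" for c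
    using l(2) [of c 1] by simp
  then show "d 0 = 0"
    by (metis fps_const_0_eq_0)
qed

lemma comm_group_Der: "comm_group Der"
proof (rule comm_groupI)
  fix d :: "'a fps \<Rightarrow> 'a fps" assume d: "d \<in> carrier Der"
  have "(\<lambda>x. - d x) \<in> carrier Der"
    by (rule DerI) (simp_all add: DerD [OF d])
  then show "\<exists>e\<in>carrier Der. e \<otimes>\<^bsub>Der\<^esub> d = \<one>\<^bsub>Der\<^esub>"
    by (rule bexI [rotated]) (simp add: Der_simps)
qed (auto simp: Der_def algebra_simps)

interpretation Der: comm_group Der
  by (rule comm_group_Der)

section \<open>Derivations as infinitesimal automorphisms\<close>

lemma der_aut_mult: "der_aut (d \<otimes>\<^bsub>Der\<^esub> e) = der_aut d \<otimes>\<^bsub>Gam\<^esub> der_aut e"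
  \<comment> \<open>\<open>der_aut e\<close> leaves reductions unchanged, so \<open>d\<close> is
    evaluated at the reduction of the same argument and the two \<epsilon>-coordinates add.\<close>
  by (auto simp: Gam_simps Der_simps fun_eq_iff intro!: dual_fps_eqI)

lemma der_aut_one: "der_aut \<one>\<^bsub>Der\<^esub> = \<one>\<^bsub>Gam\<^esub>"
  by (auto simp: Gam_simps Der_simps fun_eq_iff intro!: dual_fps_eqI)

lemma der_aut_eq_iff: "der_aut d = der_aut e \<longleftrightarrow> d = e"
proof
  assume "der_aut d = der_aut e"
  \<comment> \<open>On series with coefficients in \<open>k\<close>, the \<epsilon>-coordinate of
    \<open>der_aut d\<close> is \<open>d\<close> itself.\<close>
  then have "fps_map dual_coeff (der_aut d (fps_map dual_const x)) =
      fps_map dual_coeff (der_aut e (fps_map dual_const x))" for x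
    by simp
  then show "d = e"
    by (auto simp: fun_eq_iff)
qed auto

section \<open>Reduction along \<open>\<pi>\<close> and its kernel\<close>

lemma reduces_to_mult:
  assumes "reduces_to \<pi> \<sigma> \<tau>" "reduces_to \<pi> \<sigma>' \<tau>'"
  shows "reduces_to \<pi> (\<sigma> \<otimes>\<^bsub>Gam\<^esub> \<sigma>') (\<tau> \<otimes>\<^bsub>Gam\<^esub> \<tau>')"
  using assms by (simp add: reduces_to_def Gam_simps)

lemma reduces_to_one: "reduces_to \<pi> \<one>\<^bsub>Gam\<^esub> \<one>\<^bsub>Gam\<^esub>"
  by (simp add: reduces_to_def Gam_simps)

text \<open>Evaluate the reduction of \<open>\<sigma>\<close> at the preimage of \<open>x\<close>
  under \<open>\<sigma>\<close>, then apply the inverse of \<open>\<tau>\<close>.\<close>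

lemma reduces_to_inv:
  assumes "\<sigma> \<in> carrier Gam" "\<tau> \<in> carrier Gam" "reduces_to \<pi> \<sigma> \<tau>"
  shows "reduces_to \<pi> (inv\<^bsub>Gam\<^esub> \<sigma>) (inv\<^bsub>Gam\<^esub> \<tau>)"
  unfolding reduces_to_def
proof
  fix x
  have "fps_map \<pi> x = \<tau> (fps_map \<pi> ((inv\<^bsub>Gam\<^esub> \<sigma>) x))"
    using assms(1,3) by (simp add: reduces_to_def flip: assms(3) [unfolded reduces_to_def, rule_format])
  then show "fps_map \<pi> ((inv\<^bsub>Gam\<^esub> \<sigma>) x) = (inv\<^bsub>Gam\<^esub> \<tau>) (fps_map \<pi> x)"
    using assms(2) by simp
qed

lemma red_kernel_iff: "u \<in> red_kernel \<pi> \<longleftrightarrow> u \<in> carrier Gam \<and> reduces_to \<pi> u \<one>\<^bsub>Gam\<^esub>"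
  by (simp add: red_kernel_def Gam_simps)

lemma subgroup_red_kernel: "subgroup (red_kernel \<pi>) Gam"
proof
  show "u \<otimes>\<^bsub>Gam\<^esub> v \<in> red_kernel \<pi>" if "u \<in> red_kernel \<pi>" "v \<in> red_kernel \<pi>" for u v
    using that reduces_to_mult [of \<pi> u _ v] unfolding red_kernel_iff by fastforce
  show "inv\<^bsub>Gam\<^esub> u \<in> red_kernel \<pi>" if "u \<in> red_kernel \<pi>" for u
    using that reduces_to_inv [of u _ \<pi>] unfolding red_kernel_iff by fastforce
qed (auto simp: red_kernel_iff reduces_to_one)

text \<open>In the \<epsilon>-coordinate, multiplicativity of \<open>der_aut d\<close> is the
  Leibniz rule, and constants are fixed because derivations vanish on them. The inverse is
  \<open>der_aut\<close> of the negated derivation.\<close>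

lemma der_aut_in_red_kernel:
  assumes "d \<in> carrier Der"
  shows "der_aut d \<in> red_kernel dual_red"
proof -
  have "der_aut d \<in> carrier Gam"
  proof (rule GamI [of _ "der_aut (inv\<^bsub>Der\<^esub> d)"])
    show "der_aut d (der_aut (inv\<^bsub>Der\<^esub> d) x) = x" for x
      using der_aut_mult [of d "inv\<^bsub>Der\<^esub> d"] assms by (simp add: der_aut_one) (simp add: Gam_simps fun_eq_iff)
    show "der_aut (inv\<^bsub>Der\<^esub> d) (der_aut d x) = x" for x
      using der_aut_mult [of "inv\<^bsub>Der\<^esub> d" d] assms by (simp add: der_aut_one) (simp add: Gam_simps fun_eq_iff)
  qed (auto intro!: dual_fps_eqI simp: DerD [OF assms] algebra_simps)
  then show ?thesis
    by (simp add: red_kernel_def reduces_to_def)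
qed

lemma der_aut_closed [simp]: "d \<in> carrier Der \<Longrightarrow> der_aut d \<in> carrier Gam"
  using der_aut_in_red_kernel by (auto simp: red_kernel_def)

text \<open>
  The derivation of \<open>u\<close> is its \<open>\<epsilon>\<close>-coordinate on constants; \<open>u\<close> is determined by it, since
  \<open>u (\<epsilon> y) = \<epsilon> u(y)\<close> depends only on the reduction of \<open>u(y)\<close>.
\<close>

lemma red_kernel_eq_der_aut:
  assumes "u \<in> red_kernel dual_red"
  obtains d where "d \<in> carrier Der" "u = der_aut d"
proof
  let ?I = "fps_map dual_const" and ?C = "fps_map dual_coeff" and ?R = "fps_map dual_red"
  define d where "d y = ?C (u (?I y))" for y
  have u: "u \<in> carrier Gam" and red: "?R (u x) = ?R x" for x
    using assms by (auto simp: red_kernel_def reduces_to_def)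
  have I: "?I (x + y) = ?I x + ?I y" "?I (x * y) = ?I x * ?I y" "?I (fps_const c) = fps_const (dual_const c)"
    for x y c
    by (auto intro!: dual_fps_eqI)
  \<comment> \<open>Because \<open>u\<close> fixes residues, the product rule for
    \<open>dual_coeff\<close> turns multiplicativity of \<open>u\<close> into the Leibniz rule for
    \<open>d\<close>.\<close>
  show "d \<in> carrier Der"
    by (rule DerI) (simp_all add: d_def I GamD [OF u] red)
  have "u x = der_aut d x" for x
  proof -
    have x: "x = ?I (?R x) + fps_const dual_eps * ?I (?C x)"
      by (rule dual_fps_eqI) simp_all
    have "u x = u (?I (?R x)) + fps_const dual_eps * u (?I (?C x))"
      by (subst x) (simp only: GamD [OF u])
    then show ?thesis
      by (intro dual_fps_eqI) (simp_all add: red d_def)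
  qed
  then show "u = der_aut d" ..
qed

lemma red_kernel_eq_image: "red_kernel dual_red = der_aut ` carrier Der"
  by (auto intro: der_aut_in_red_kernel elim: red_kernel_eq_der_aut)

section \<open>Base change as a section of the reduction\<close>

lemma base_change_mult:
  "base_change (\<sigma> \<otimes>\<^bsub>Gam\<^esub> \<tau>) = base_change \<sigma> \<otimes>\<^bsub>Gam\<^esub> base_change \<tau>"
  by (auto simp: Gam_simps fun_eq_iff intro!: dual_fps_eqI)

lemma base_change_closed [simp]:
  assumes "\<tau> \<in> carrier Gam"
  shows "base_change \<tau> \<in> carrier Gam"
  using assms
  by (intro GamI [of _ "base_change (inv\<^bsub>Gam\<^esub> \<tau>)"]) (auto simp: GamD intro!: dual_fps_eqI)

lemma reduces_to_base_change [simp]: "reduces_to dual_red (base_change \<tau>) \<tau>"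
  by (simp add: reduces_to_def)

text \<open>At the point with coordinates \<open>(a, b)\<close> both sides have coordinates
  \<open>(\<tau> a, \<tau> b + \<tau> (d a))\<close>. Moving a base change past an infinitesimal
  automorphism in this way is what makes the action on derivations appear in the cocycle
  condition.\<close>

lemma base_change_der_aut:
  assumes "\<tau> \<in> carrier Gam"
  shows "base_change \<tau> \<otimes>\<^bsub>Gam\<^esub> der_aut d = der_aut (\<tau> \<circ> d \<circ> inv\<^bsub>Gam\<^esub> \<tau>) \<otimes>\<^bsub>Gam\<^esub> base_change \<tau>"
  using assms by (auto simp: GamD Gam_simps fun_eq_iff intro!: dual_fps_eqI)

lemma Der_conj_closed:
  assumes "\<tau> \<in> carrier Gam" "d \<in> carrier Der"
  shows "\<tau> \<circ> d \<circ> inv\<^bsub>Gam\<^esub> \<tau> \<in> carrier Der"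
proof -
  have "inv\<^bsub>Gam\<^esub> \<tau> \<in> carrier Gam"
    using assms by simp
  note \<tau> = GamD [OF assms(1)] GamD [OF this] and d = DerD [OF assms(2)]
  show ?thesis
    by (rule DerI) (simp_all add: \<tau> d assms(1))
qed

text \<open>The intertwining form on the right is the one in which equivalences of lifts are
  composed and translated into relations between cocycles.\<close>

lemma Gam_conj_iff:
  assumes "u \<in> carrier Gam" "x \<in> carrier Gam" "y \<in> carrier Gam"
  shows "y = u \<otimes>\<^bsub>Gam\<^esub> x \<otimes>\<^bsub>Gam\<^esub> inv\<^bsub>Gam\<^esub> u \<longleftrightarrow> y \<otimes>\<^bsub>Gam\<^esub> u = u \<otimes>\<^bsub>Gam\<^esub> x"
  using assms by (auto simp: Gam.m_assoc) (metis Gam.inv_closed Gam.m_assoc Gam.r_inv Gam.r_one)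


section \<open>Lifts and cocycles\<close>

lemma carrier_H1: "carrier (H1 G M a) = H1_class G M a ` carrier (Z1 G M a)"
  by (auto simp: H1_def FactGroup_def RCOSETS_def H1_class_def)

text \<open>The group is a parameter, so that every fact about lifts and cocycles is available for
  \<open>G\<close> and, through a second instance with the same \<open>\<rho>\<close>, for
  \<open>N\<close>.\<close>

locale aut_action = group G for G :: "('g, 'm) monoid_scheme" (structure) +
  fixes \<rho> :: "'g \<Rightarrow> 'k::field fps \<Rightarrow> 'k fps"
  assumes hom_rho: "\<rho> \<in> hom G Gam"
begin

lemma rho_closed [simp]: "g \<in> carrier G \<Longrightarrow> \<rho> g \<in> carrier Gam"
  using hom_rho by (auto simp: hom_def)

lemma rho_mult: "g \<in> carrier G \<Longrightarrow> h \<in> carrier G \<Longrightarrow> \<rho> (g \<otimes> h) = \<rho> g \<otimes>\<^bsub>Gam\<^esub> \<rho> h"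
  using hom_rho by (auto simp: hom_def)

lemma rho_inv: "g \<in> carrier G \<Longrightarrow> \<rho> (inv g) = inv\<^bsub>Gam\<^esub> (\<rho> g)"
  using group_hom.hom_inv [of G Gam \<rho>] hom_rho
  by (simp add: group_hom_def group_hom_axioms_def group_Gam is_group)

lemma liftsD:
  assumes "\<sigma> \<in> lifts \<pi> G \<rho>"
  shows "\<sigma> \<in> extensional (carrier G)"
    and "g \<in> carrier G \<Longrightarrow> \<sigma> g \<in> carrier Gam"
    and "g \<in> carrier G \<Longrightarrow> h \<in> carrier G \<Longrightarrow> \<sigma> (g \<otimes> h) = \<sigma> g \<otimes>\<^bsub>Gam\<^esub> \<sigma> h"
    and "g \<in> carrier G \<Longrightarrow> reduces_to \<pi> (\<sigma> g) (\<rho> g)"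
  using assms by (auto simp: lifts_def hom_def)

section \<open>Equivalence classes of lifts\<close>

lemma lift_equiv_iff:
  "(\<sigma>, \<sigma>') \<in> lift_equiv \<pi> G \<rho> \<longleftrightarrow> \<sigma> \<in> lifts \<pi> G \<rho> \<and> \<sigma>' \<in> lifts \<pi> G \<rho> \<and>
     (\<exists>u\<in>red_kernel \<pi>. \<forall>g\<in>carrier G. \<sigma>' g \<otimes>\<^bsub>Gam\<^esub> u = u \<otimes>\<^bsub>Gam\<^esub> \<sigma> g)"
  unfolding lift_equiv_def
  by (auto simp: Gam_conj_iff [OF _ liftsD(2) liftsD(2)] red_kernel_iff intro!: bexI)

lemma equiv_lift_equiv: "equiv (lifts \<pi> G \<rho>) (lift_equiv \<pi> G \<rho>)"
proof (rule equivI)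
  note K = subgroup_red_kernel [of \<pi>]
  note [simp] = subgroup.mem_carrier [OF K] subgroup.m_closed [OF K] subgroup.m_inv_closed [OF K]
    subgroup.one_closed [OF K]
  show "lift_equiv \<pi> G \<rho> \<subseteq> lifts \<pi> G \<rho> \<times> lifts \<pi> G \<rho>"
    by (auto simp: lift_equiv_def)
  show "refl_on (lifts \<pi> G \<rho>) (lift_equiv \<pi> G \<rho>)"
    by (auto simp: refl_on_def lift_equiv_iff liftsD intro!: bexI [of _ "\<one>\<^bsub>Gam\<^esub>"])
  show "sym (lift_equiv \<pi> G \<rho>)"
  proof (rule symI)
    fix \<sigma> \<sigma>' assume "(\<sigma>, \<sigma>') \<in> lift_equiv \<pi> G \<rho>"
    then obtain u where u: "u \<in> red_kernel \<pi>" "\<And>g. g \<in> carrier G \<Longrightarrow> \<sigma>' g \<otimes>\<^bsub>Gam\<^esub> u = u \<otimes>\<^bsub>Gam\<^esub> \<sigma> g"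
      and \<sigma>: "\<sigma> \<in> lifts \<pi> G \<rho>" "\<sigma>' \<in> lifts \<pi> G \<rho>"
      by (auto simp: lift_equiv_iff)
    have "\<sigma> g \<otimes>\<^bsub>Gam\<^esub> inv\<^bsub>Gam\<^esub> u = inv\<^bsub>Gam\<^esub> u \<otimes>\<^bsub>Gam\<^esub> \<sigma>' g" if "g \<in> carrier G" for g
    proof -
      \<comment> \<open>Multiplying the intertwining relation by the inverse of \<open>u\<close> on
        both sides exchanges the roles of the two lifts.\<close>
      have "inv\<^bsub>Gam\<^esub> u \<otimes>\<^bsub>Gam\<^esub> (\<sigma>' g \<otimes>\<^bsub>Gam\<^esub> u) \<otimes>\<^bsub>Gam\<^esub> inv\<^bsub>Gam\<^esub> u = inv\<^bsub>Gam\<^esub> u \<otimes>\<^bsub>Gam\<^esub> (u \<otimes>\<^bsub>Gam\<^esub> \<sigma> g) \<otimes>\<^bsub>Gam\<^esub> inv\<^bsub>Gam\<^esub> u"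
        using u that by simp
      then show ?thesis
        using u(1) that \<sigma> by (simp add: Gam.m_assoc liftsD)
    qed
    then show "(\<sigma>', \<sigma>) \<in> lift_equiv \<pi> G \<rho>"
      using \<sigma> u(1) by (auto simp: lift_equiv_iff intro!: bexI [of _ "inv\<^bsub>Gam\<^esub> u"])
  qed
  show "trans (lift_equiv \<pi> G \<rho>)"
  proof (rule transI)
    fix \<sigma> \<sigma>' \<sigma>'' assume "(\<sigma>, \<sigma>') \<in> lift_equiv \<pi> G \<rho>" "(\<sigma>', \<sigma>'') \<in> lift_equiv \<pi> G \<rho>"
    then obtain u v where u: "u \<in> red_kernel \<pi>" "\<And>g. g \<in> carrier G \<Longrightarrow> \<sigma>' g \<otimes>\<^bsub>Gam\<^esub> u = u \<otimes>\<^bsub>Gam\<^esub> \<sigma> g"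
      and v: "v \<in> red_kernel \<pi>" "\<And>g. g \<in> carrier G \<Longrightarrow> \<sigma>'' g \<otimes>\<^bsub>Gam\<^esub> v = v \<otimes>\<^bsub>Gam\<^esub> \<sigma>' g"
      and \<sigma>: "\<sigma> \<in> lifts \<pi> G \<rho>" "\<sigma>' \<in> lifts \<pi> G \<rho>" "\<sigma>'' \<in> lifts \<pi> G \<rho>"
      by (auto simp: lift_equiv_iff)
    have "\<sigma>'' g \<otimes>\<^bsub>Gam\<^esub> (v \<otimes>\<^bsub>Gam\<^esub> u) = v \<otimes>\<^bsub>Gam\<^esub> u \<otimes>\<^bsub>Gam\<^esub> \<sigma> g" if g: "g \<in> carrier G" for g
    proof -
      have "\<sigma>'' g \<otimes>\<^bsub>Gam\<^esub> (v \<otimes>\<^bsub>Gam\<^esub> u) = v \<otimes>\<^bsub>Gam\<^esub> \<sigma>' g \<otimes>\<^bsub>Gam\<^esub> u"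
        using u(1) v g \<sigma> by (simp add: liftsD flip: Gam.m_assoc)
      also have "\<dots> = v \<otimes>\<^bsub>Gam\<^esub> u \<otimes>\<^bsub>Gam\<^esub> \<sigma> g"
        using u v(1) g \<sigma> by (simp add: liftsD Gam.m_assoc)
      finally show ?thesis .
    qed
    then show "(\<sigma>, \<sigma>'') \<in> lift_equiv \<pi> G \<rho>"
      using \<sigma> u(1) v(1) by (auto simp: lift_equiv_iff intro!: bexI [of _ "v \<otimes>\<^bsub>Gam\<^esub> u"])
  qed
qed

text \<open>Conjugation preserves homomorphisms, and a conjugating element that reduces to the
  identity leaves the reduction \<open>\<rho> g\<close> unchanged. This later supplies the cocycle
  property of a function known only to differ from a cocycle by a coboundary.\<close>

lemma conj_in_lifts:
  assumes \<sigma>: "\<sigma> \<in> lifts \<pi> G \<rho>" and u: "u \<in> red_kernel \<pi>" and ext: "\<sigma>' \<in> extensional (carrier G)"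
    and eq: "\<And>g. g \<in> carrier G \<Longrightarrow> \<sigma>' g = u \<otimes>\<^bsub>Gam\<^esub> \<sigma> g \<otimes>\<^bsub>Gam\<^esub> inv\<^bsub>Gam\<^esub> u"
  shows "\<sigma>' \<in> lifts \<pi> G \<rho>"
proof -
  have [simp]: "u \<in> carrier Gam" and red: "reduces_to \<pi> u \<one>\<^bsub>Gam\<^esub>"
    using u by (simp_all add: red_kernel_iff)
  have "reduces_to \<pi> (\<sigma>' g) (\<one>\<^bsub>Gam\<^esub> \<otimes>\<^bsub>Gam\<^esub> \<rho> g \<otimes>\<^bsub>Gam\<^esub> inv\<^bsub>Gam\<^esub> \<one>\<^bsub>Gam\<^esub>)" if g: "g \<in> carrier G" for g
    unfolding eq [OF g] using g red \<sigma> by (intro reduces_to_mult reduces_to_inv) (auto simp: liftsD)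
  then show ?thesis
    using ext \<sigma> by (auto simp: lifts_def hom_def Pi_iff eq Gam.m_assoc)
qed

lemma lift_class_eq_iff:
  assumes "\<sigma> \<in> lifts \<pi> G \<rho>" "\<sigma>' \<in> lifts \<pi> G \<rho>"
  shows "lift_class \<pi> G \<rho> \<sigma> = lift_class \<pi> G \<rho> \<sigma>' \<longleftrightarrow> (\<sigma>, \<sigma>') \<in> lift_equiv \<pi> G \<rho>"
  unfolding lift_class_def using eq_equiv_class_iff [OF equiv_lift_equiv] assms by blast

lemma def_functor_eq: "def_functor \<pi> G \<rho> = lift_class \<pi> G \<rho> ` lifts \<pi> G \<rho>"
  by (auto simp: def_functor_def quotient_def lift_class_def)

lemma lift_class_self: "\<sigma> \<in> lifts \<pi> G \<rho> \<Longrightarrow> \<sigma> \<in> lift_class \<pi> G \<rho> \<sigma>"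
  unfolding lift_class_def by (rule equiv_class_self [OF equiv_lift_equiv])

section \<open>Lifts to the dual numbers as cocycles\<close>

lemma der_act_closed [simp]: "g \<in> carrier G \<Longrightarrow> d \<in> carrier Der \<Longrightarrow> der_act \<rho> g d \<in> carrier Der"
  by (simp add: der_act_def Der_conj_closed)

lemma base_change_rho_der_aut:
  "g \<in> carrier G \<Longrightarrow>
    base_change (\<rho> g) \<otimes>\<^bsub>Gam\<^esub> der_aut d = der_aut (der_act \<rho> g d) \<otimes>\<^bsub>Gam\<^esub> base_change (\<rho> g)"
  by (simp add: base_change_der_aut der_act_def)

text \<open>In the product of the values at \<open>g\<close> and \<open>h\<close>, moving
  \<open>base_change (\<rho> g)\<close> past \<open>der_aut (\<gamma> h)\<close> turns
  \<open>\<gamma> h\<close> into \<open>der_act \<rho> g (\<gamma> h)\<close>. Cancelling the common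
  base changes leaves the cocycle condition, since \<open>der_aut\<close> is injective. The
  direction from lifts to cocycles later produces new cocycles.\<close>

lemma cocycle_lift_in_lifts_iff:
  assumes \<gamma>: "\<gamma> \<in> carrier G \<rightarrow>\<^sub>E carrier Der"
  shows "cocycle_lift G \<rho> \<gamma> \<in> lifts dual_red G \<rho> \<longleftrightarrow> \<gamma> \<in> carrier (Z1 G Der (der_act \<rho>))"
proof -
  let ?L = "cocycle_lift G \<rho> \<gamma>"
  have [simp]: "\<gamma> g \<in> carrier Der" if "g \<in> carrier G" for g
    using \<gamma> that by auto
  have L: "?L g = der_aut (\<gamma> g) \<otimes>\<^bsub>Gam\<^esub> base_change (\<rho> g)" if "g \<in> carrier G" for g
    using that by (simp add: cocycle_lift_def)
  have closed: "?L g \<in> carrier Gam" "reduces_to dual_red (?L g) (\<rho> g)" if "g \<in> carrier G" for g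
    using that reduces_to_mult [of dual_red "der_aut (\<gamma> g)" "\<one>\<^bsub>Gam\<^esub>" "base_change (\<rho> g)" "\<rho> g"]
      der_aut_in_red_kernel [of "\<gamma> g"]
    by (auto simp: L red_kernel_iff)
  have "?L (g \<otimes> h) = ?L g \<otimes>\<^bsub>Gam\<^esub> ?L h \<longleftrightarrow> \<gamma> (g \<otimes> h) = \<gamma> g \<otimes>\<^bsub>Der\<^esub> der_act \<rho> g (\<gamma> h)"
    if [simp]: "g \<in> carrier G" "h \<in> carrier G" for g h
  proof -
    let ?s = "base_change (\<rho> g) \<otimes>\<^bsub>Gam\<^esub> base_change (\<rho> h)"
    have 1: "?L (g \<otimes> h) = der_aut (\<gamma> (g \<otimes> h)) \<otimes>\<^bsub>Gam\<^esub> ?s"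
      by (simp add: L rho_mult base_change_mult)
    have "?L g \<otimes>\<^bsub>Gam\<^esub> ?L h =
        der_aut (\<gamma> g) \<otimes>\<^bsub>Gam\<^esub> (base_change (\<rho> g) \<otimes>\<^bsub>Gam\<^esub> der_aut (\<gamma> h)) \<otimes>\<^bsub>Gam\<^esub> base_change (\<rho> h)"
      by (simp add: L Gam.m_assoc)
    also have "\<dots> = der_aut (\<gamma> g \<otimes>\<^bsub>Der\<^esub> der_act \<rho> g (\<gamma> h)) \<otimes>\<^bsub>Gam\<^esub> ?s"
      by (simp add: base_change_rho_der_aut der_aut_mult Gam.m_assoc)
    finally show ?thesis
      by (simp add: 1 der_aut_eq_iff)
  qed
  then show ?thesis
    using closed \<gamma> by (auto simp: lifts_def Z1_def hom_def Pi_iff) (auto simp: cocycle_lift_def)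
qed

lemma Z1_funcset: "\<gamma> \<in> carrier (Z1 G Der (der_act \<rho>)) \<Longrightarrow> \<gamma> \<in> carrier G \<rightarrow>\<^sub>E carrier Der"
  by (simp add: Z1_def)

lemma cocycle_lift_in_lifts:
  "\<gamma> \<in> carrier (Z1 G Der (der_act \<rho>)) \<Longrightarrow> cocycle_lift G \<rho> \<gamma> \<in> lifts dual_red G \<rho>"
  using cocycle_lift_in_lifts_iff Z1_funcset by blast

text \<open>\<open>\<sigma> g\<close> times the inverse of \<open>base_change (\<rho> g)\<close>
  reduces to the identity, hence is \<open>der_aut\<close> of a derivation. Choosing one for each
  \<open>g\<close> gives a cochain, which is a cocycle because \<open>\<sigma>\<close> is a
  lift.\<close>

lemma lift_eq_cocycle_lift:
  assumes \<sigma>: "\<sigma> \<in> lifts dual_red G \<rho>"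
  obtains \<gamma> where "\<gamma> \<in> carrier (Z1 G Der (der_act \<rho>))" "\<sigma> = cocycle_lift G \<rho> \<gamma>"
proof -
  have "\<exists>d. d \<in> carrier Der \<and> \<sigma> g = der_aut d \<otimes>\<^bsub>Gam\<^esub> base_change (\<rho> g)" if g: "g \<in> carrier G" for g
  proof -
    have "reduces_to dual_red (\<sigma> g \<otimes>\<^bsub>Gam\<^esub> inv\<^bsub>Gam\<^esub> (base_change (\<rho> g))) (\<rho> g \<otimes>\<^bsub>Gam\<^esub> inv\<^bsub>Gam\<^esub> (\<rho> g))"
      using g \<sigma> by (intro reduces_to_mult reduces_to_inv) (auto simp: liftsD)
    then have "\<sigma> g \<otimes>\<^bsub>Gam\<^esub> inv\<^bsub>Gam\<^esub> (base_change (\<rho> g)) \<in> red_kernel dual_red"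
      using g \<sigma> by (simp add: red_kernel_iff liftsD)
    then obtain d where "d \<in> carrier Der" "\<sigma> g \<otimes>\<^bsub>Gam\<^esub> inv\<^bsub>Gam\<^esub> (base_change (\<rho> g)) = der_aut d"
      by (rule red_kernel_eq_der_aut)
    then show ?thesis
      using g \<sigma> by (intro exI [of _ d]) (auto simp: liftsD Gam.m_assoc dest!: sym [of _ "der_aut d"])
  qed
  then obtain f where f: "\<And>g. g \<in> carrier G \<Longrightarrow> f g \<in> carrier Der"
    "\<And>g. g \<in> carrier G \<Longrightarrow> \<sigma> g = der_aut (f g) \<otimes>\<^bsub>Gam\<^esub> base_change (\<rho> g)"
    by metis
  have eq: "\<sigma> = cocycle_lift G \<rho> (restrict f (carrier G))"
    using liftsD(1) [OF \<sigma>] f(2) by (auto simp: cocycle_lift_def fun_eq_iff extensional_def)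
  moreover have "restrict f (carrier G) \<in> carrier (Z1 G Der (der_act \<rho>))"
    using cocycle_lift_in_lifts_iff [of "restrict f (carrier G)"] \<sigma> f(1) eq by auto
  ultimately show thesis
    using that by blast
qed

section \<open>Cohomologous cocycles and equivalent lifts\<close>

lemma H1_class_iff_lift_equiv:
  assumes \<gamma>: "\<gamma> \<in> carrier (Z1 G Der (der_act \<rho>))" and \<gamma>': "\<gamma>' \<in> carrier G \<rightarrow>\<^sub>E carrier Der"
  shows "\<gamma>' \<in> H1_class G Der (der_act \<rho>) \<gamma> \<longleftrightarrow>
    (cocycle_lift G \<rho> \<gamma>, cocycle_lift G \<rho> \<gamma>') \<in> lift_equiv dual_red G \<rho>"
proof -
  let ?L = "cocycle_lift G \<rho>"
  have [simp]: "\<gamma> g \<in> carrier Der" "\<gamma>' g \<in> carrier Der" if "g \<in> carrier G" for g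
    using Z1_funcset [OF \<gamma>] \<gamma>' that by auto
  \<comment> \<open>\<open>cob m\<close> records that \<open>\<gamma>'\<close> is
    \<open>\<gamma>\<close> plus the coboundary of \<open>m\<close>. In terms of derivations, the
    relation in \<open>key\<close> reads
    \<open>\<gamma> g + der_act \<rho> g m = m + \<gamma>' g\<close>, which is the same
    condition.\<close>
  define cob where "cob m \<longleftrightarrow> m \<in> carrier Der \<and>
    (\<forall>g\<in>carrier G. \<gamma>' g = der_act \<rho> g m \<otimes>\<^bsub>Der\<^esub> inv\<^bsub>Der\<^esub> m \<otimes>\<^bsub>Der\<^esub> \<gamma> g)" for m
  have key: "cob m \<longleftrightarrow> (\<forall>g\<in>carrier G. ?L \<gamma> g \<otimes>\<^bsub>Gam\<^esub> der_aut m = der_aut m \<otimes>\<^bsub>Gam\<^esub> ?L \<gamma>' g)"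
    if [simp]: "m \<in> carrier Der" for m
  proof -
    have "\<gamma>' g = der_act \<rho> g m \<otimes>\<^bsub>Der\<^esub> inv\<^bsub>Der\<^esub> m \<otimes>\<^bsub>Der\<^esub> \<gamma> g \<longleftrightarrow>
        ?L \<gamma> g \<otimes>\<^bsub>Gam\<^esub> der_aut m = der_aut m \<otimes>\<^bsub>Gam\<^esub> ?L \<gamma>' g" if [simp]: "g \<in> carrier G" for g
    proof -
      have 1: "?L \<gamma> g \<otimes>\<^bsub>Gam\<^esub> der_aut m = der_aut (\<gamma> g \<otimes>\<^bsub>Der\<^esub> der_act \<rho> g m) \<otimes>\<^bsub>Gam\<^esub> base_change (\<rho> g)"
        by (simp add: cocycle_lift_def Gam.m_assoc base_change_rho_der_aut der_aut_mult)
      have 2: "der_aut m \<otimes>\<^bsub>Gam\<^esub> ?L \<gamma>' g = der_aut (m \<otimes>\<^bsub>Der\<^esub> \<gamma>' g) \<otimes>\<^bsub>Gam\<^esub> base_change (\<rho> g)"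
        by (simp add: cocycle_lift_def Gam.m_assoc der_aut_mult)
      have "?L \<gamma> g \<otimes>\<^bsub>Gam\<^esub> der_aut m = der_aut m \<otimes>\<^bsub>Gam\<^esub> ?L \<gamma>' g \<longleftrightarrow>
          \<gamma> g \<otimes>\<^bsub>Der\<^esub> der_act \<rho> g m = m \<otimes>\<^bsub>Der\<^esub> \<gamma>' g"
        unfolding 1 2 by (simp add: der_aut_eq_iff)
      also have "\<dots> \<longleftrightarrow> \<gamma>' g = inv\<^bsub>Der\<^esub> m \<otimes>\<^bsub>Der\<^esub> (\<gamma> g \<otimes>\<^bsub>Der\<^esub> der_act \<rho> g m)"
        by (subst Der.inv_solve_left) auto
      also have "inv\<^bsub>Der\<^esub> m \<otimes>\<^bsub>Der\<^esub> (\<gamma> g \<otimes>\<^bsub>Der\<^esub> der_act \<rho> g m) =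
          der_act \<rho> g m \<otimes>\<^bsub>Der\<^esub> inv\<^bsub>Der\<^esub> m \<otimes>\<^bsub>Der\<^esub> \<gamma> g"
        by (simp add: Der.m_ac)
      finally show ?thesis ..
    qed
    then show ?thesis
      by (simp add: cob_def)
  qed
  have "\<gamma>' \<in> H1_class G Der (der_act \<rho>) \<gamma> \<longleftrightarrow> (\<exists>m\<in>carrier Der. cob m)"
  proof -
    have "\<gamma>' \<in> H1_class G Der (der_act \<rho>) \<gamma> \<longleftrightarrow> (\<exists>m\<in>carrier Der.
        \<gamma>' = (\<lambda>g\<in>carrier G. der_act \<rho> g m \<otimes>\<^bsub>Der\<^esub> inv\<^bsub>Der\<^esub> m \<otimes>\<^bsub>Der\<^esub> \<gamma> g))"
      by (auto simp: H1_class_def r_coset_def B1_def Z1_def cong: restrict_cong)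
    moreover have "\<gamma>' = restrict f (carrier G) \<longleftrightarrow> (\<forall>g\<in>carrier G. \<gamma>' g = f g)" for f
      using \<gamma>' by (metis PiE_restrict restrict_apply' restrict_ext)
    ultimately show ?thesis
      by (simp add: cob_def)
  qed
  also have "\<dots> \<longleftrightarrow> (\<exists>m\<in>carrier Der. \<forall>g\<in>carrier G. ?L \<gamma> g \<otimes>\<^bsub>Gam\<^esub> der_aut m = der_aut m \<otimes>\<^bsub>Gam\<^esub> ?L \<gamma>' g)"
    by (intro bex_cong refl key)
  also have "\<dots> \<longleftrightarrow> (\<exists>u\<in>red_kernel dual_red. \<forall>g\<in>carrier G. ?L \<gamma> g \<otimes>\<^bsub>Gam\<^esub> u = u \<otimes>\<^bsub>Gam\<^esub> ?L \<gamma>' g)"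
    by (simp add: red_kernel_eq_image)
  finally have *: "\<gamma>' \<in> H1_class G Der (der_act \<rho>) \<gamma> \<longleftrightarrow> \<dots>" .
  \<comment> \<open>Here \<open>\<gamma>'\<close> is only a function; its lift property is inherited
    from \<open>\<gamma>\<close> through conjugation by the inverse of \<open>u\<close>.\<close>
  have "?L \<gamma>' \<in> lifts dual_red G \<rho>"
    if u: "u \<in> red_kernel dual_red" and eq: "\<forall>g\<in>carrier G. ?L \<gamma> g \<otimes>\<^bsub>Gam\<^esub> u = u \<otimes>\<^bsub>Gam\<^esub> ?L \<gamma>' g" for u
  proof (rule conj_in_lifts [OF cocycle_lift_in_lifts [OF \<gamma>]])
    show u': "inv\<^bsub>Gam\<^esub> u \<in> red_kernel dual_red"
      using u by (rule subgroup.m_inv_closed [OF subgroup_red_kernel])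
    show "?L \<gamma>' \<in> extensional (carrier G)"
      by (simp add: cocycle_lift_def)
    fix g assume g: "g \<in> carrier G"
    then have "?L \<gamma> g \<in> carrier Gam" "?L \<gamma>' g \<in> carrier Gam"
      by (simp_all add: cocycle_lift_def)
    then show "?L \<gamma>' g = inv\<^bsub>Gam\<^esub> u \<otimes>\<^bsub>Gam\<^esub> ?L \<gamma> g \<otimes>\<^bsub>Gam\<^esub> inv\<^bsub>Gam\<^esub> (inv\<^bsub>Gam\<^esub> u)"
      using u eq g by (simp add: red_kernel_iff Gam.m_assoc)
  qed
  \<comment> \<open>The relation runs from \<open>\<gamma>'\<close> to \<open>\<gamma>\<close>,
    because \<open>u\<close> stands to the right of the lift of \<open>\<gamma>\<close>; symmetry
    then restores the order of the claim.\<close>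
  then have "\<gamma>' \<in> H1_class G Der (der_act \<rho>) \<gamma> \<longleftrightarrow> (?L \<gamma>', ?L \<gamma>) \<in> lift_equiv dual_red G \<rho>"
    unfolding * lift_equiv_iff using cocycle_lift_in_lifts [OF \<gamma>] by auto
  then show ?thesis
    using equiv_lift_equiv [of dual_red] by (meson equiv_def symE)
qed

text \<open>Cosets of coboundaries inherit from lift equivalence that they partition the cocycles:
  equality of cohomology classes, and membership in them, can henceforth be decided on
  lifts.\<close>

lemma H1_class_eq_vimage:
  assumes "\<gamma> \<in> carrier (Z1 G Der (der_act \<rho>))"
  shows "H1_class G Der (der_act \<rho>) \<gamma> =
    {\<gamma>' \<in> carrier (Z1 G Der (der_act \<rho>)). cocycle_lift G \<rho> \<gamma>' \<in> lift_class dual_red G \<rho> (cocycle_lift G \<rho> \<gamma>)}"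
    (is "?H = ?V")
proof -
  \<comment> \<open>The comparison with lifts applies only to extensional functions into
    \<open>Der\<close>, so the coset is first shown to consist of these.\<close>
  have sub: "?H \<subseteq> carrier G \<rightarrow>\<^sub>E carrier Der"
    using PiE_mem [OF Z1_funcset [OF assms]]
    by (auto simp: H1_class_def r_coset_def B1_def Z1_def intro!: Der.m_closed)
  show ?thesis
  proof
    show "?H \<subseteq> ?V"
    proof
      fix \<gamma>' assume \<gamma>': "\<gamma>' \<in> ?H"
      then have "\<gamma>' \<in> carrier G \<rightarrow>\<^sub>E carrier Der"
        using sub by blast
      then show "\<gamma>' \<in> ?V"
        using \<gamma>' H1_class_iff_lift_equiv [OF assms] cocycle_lift_in_lifts_iff
        by (auto simp: lift_class_def lift_equiv_iff)
    qed
    show "?V \<subseteq> ?H"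
      using H1_class_iff_lift_equiv [OF assms] Z1_funcset by (auto simp: lift_class_def)
  qed
qed

lemma H1_class_eq_iff:
  assumes "\<gamma> \<in> carrier (Z1 G Der (der_act \<rho>))" "\<gamma>' \<in> carrier (Z1 G Der (der_act \<rho>))"
  shows "H1_class G Der (der_act \<rho>) \<gamma> = H1_class G Der (der_act \<rho>) \<gamma>' \<longleftrightarrow>
    lift_class dual_red G \<rho> (cocycle_lift G \<rho> \<gamma>) = lift_class dual_red G \<rho> (cocycle_lift G \<rho> \<gamma>')"
proof
  assume "H1_class G Der (der_act \<rho>) \<gamma> = H1_class G Der (der_act \<rho>) \<gamma>'"
  then have "cocycle_lift G \<rho> \<gamma>' \<in> lift_class dual_red G \<rho> (cocycle_lift G \<rho> \<gamma>)"
    using assms lift_class_self [OF cocycle_lift_in_lifts [OF assms(2)]]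
    by (auto simp: H1_class_eq_vimage)
  then show "lift_class dual_red G \<rho> (cocycle_lift G \<rho> \<gamma>) = lift_class dual_red G \<rho> (cocycle_lift G \<rho> \<gamma>')"
    using assms by (subst lift_class_eq_iff) (auto simp: cocycle_lift_in_lifts lift_class_def)
qed (use assms in \<open>simp add: H1_class_eq_vimage\<close>)

lemma H1_class_self:
  "\<gamma> \<in> carrier (Z1 G Der (der_act \<rho>)) \<Longrightarrow> \<gamma> \<in> H1_class G Der (der_act \<rho>) \<gamma>"
  by (simp add: H1_class_eq_vimage cocycle_lift_in_lifts lift_class_self)

text \<open>All members of the cohomology class have equivalent lifts, and \<open>\<gamma>\<close>
  itself is a member; so the defining union is a nonempty union of one repeated class.\<close>

lemma tangent_of_H1_class:
  assumes "\<gamma> \<in> carrier (Z1 G Der (der_act \<rho>))"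
  shows "tangent_of_H1 G \<rho> (H1_class G Der (der_act \<rho>) \<gamma>) = lift_class dual_red G \<rho> (cocycle_lift G \<rho> \<gamma>)"
proof -
  have "lift_class dual_red G \<rho> (cocycle_lift G \<rho> \<gamma>') = lift_class dual_red G \<rho> (cocycle_lift G \<rho> \<gamma>)"
    if "\<gamma>' \<in> H1_class G Der (der_act \<rho>) \<gamma>" for \<gamma>'
  proof -
    have "(cocycle_lift G \<rho> \<gamma>, cocycle_lift G \<rho> \<gamma>') \<in> lift_equiv dual_red G \<rho>"
      using that assms by (simp add: H1_class_eq_vimage lift_class_def)
    then show ?thesis
      by (subst eq_commute) (simp add: lift_class_eq_iff lift_equiv_iff)
  qed
  then show ?thesis
    unfolding tangent_of_H1_def using H1_class_self [OF assms] by (blast intro: SUP_eq_const)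
qed

text \<open>Injectivity is \<open>H1_class_eq_iff\<close> on representatives; surjectivity holds
  because every lift comes from a cocycle.\<close>

lemma bij_betw_tangent_of_H1:
  "bij_betw (tangent_of_H1 G \<rho>) (carrier (H1 G Der (der_act \<rho>))) (tangent_space G \<rho>)"
  unfolding bij_betw_def
proof
  show "inj_on (tangent_of_H1 G \<rho>) (carrier (H1 G Der (der_act \<rho>)))"
    by (auto simp: inj_on_def carrier_H1 tangent_of_H1_class H1_class_eq_iff)
  have "lifts dual_red G \<rho> = cocycle_lift G \<rho> ` carrier (Z1 G Der (der_act \<rho>))"
  proof
    show "lifts dual_red G \<rho> \<subseteq> cocycle_lift G \<rho> ` carrier (Z1 G Der (der_act \<rho>))"
      by (metis image_eqI lift_eq_cocycle_lift subsetI)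
  qed (use cocycle_lift_in_lifts in blast)
  then show "tangent_of_H1 G \<rho> ` carrier (H1 G Der (der_act \<rho>)) = tangent_space G \<rho>"
    by (simp add: carrier_H1 def_functor_eq image_image tangent_of_H1_class cong: image_cong)
qed

end


section \<open>The action of the quotient and the restriction\<close>

locale normal_aut_action = aut_action G \<rho> + normal N G
  for G :: "('g, 'm) monoid_scheme" (structure) and N :: "'g set"
    and \<rho> :: "'g \<Rightarrow> 'k::field fps \<Rightarrow> 'k fps"
begin

sublocale N: aut_action "G\<lparr>carrier := N\<rparr>" \<rho>
proof (intro aut_action.intro aut_action_axioms.intro)
  show "group (G\<lparr>carrier := N\<rparr>)"
    by (rule subgroup_imp_group) (rule subgroup_axioms)
  show "\<rho> \<in> hom (G\<lparr>carrier := N\<rparr>) Gam"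
    using subset by (auto simp: hom_def rho_mult)
qed

section \<open>Conjugation of lifts by elements of \<open>G\<close>\<close>

lemma conj_mem [simp]: "g \<in> carrier G \<Longrightarrow> n \<in> N \<Longrightarrow> inv g \<otimes> n \<otimes> g \<in> N"
  by (rule inv_op_closed1)

lemma N_carrier [simp]: "n \<in> N \<Longrightarrow> n \<in> carrier G"
  by (rule mem_carrier)

lemma conj_mult:
  assumes "g \<in> carrier G" "m \<in> carrier G" "n \<in> carrier G"
  shows "inv g \<otimes> (m \<otimes> n) \<otimes> g = (inv g \<otimes> m \<otimes> g) \<otimes> (inv g \<otimes> n \<otimes> g)"
  using assms by (simp add: m_assoc)

lemma conj_lift_in_lifts:
  assumes g: "g \<in> carrier G" and r: "r \<in> carrier Gam" "reduces_to \<pi> r (\<rho> g)"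
    and \<sigma>: "\<sigma> \<in> lifts \<pi> (G\<lparr>carrier := N\<rparr>) \<rho>"
  shows "conj_lift G N g r \<sigma> \<in> lifts \<pi> (G\<lparr>carrier := N\<rparr>) \<rho>"
proof -
  note \<sigma>D = N.liftsD [OF \<sigma>, simplified]
  let ?c = "conj_lift G N g r \<sigma>"
  have mult: "?c (m \<otimes> n) = ?c m \<otimes>\<^bsub>Gam\<^esub> ?c n" if "m \<in> N" "n \<in> N" for m n
    using that g r(1) by (simp add: conj_lift_def conj_mult \<sigma>D Gam.m_assoc)
  have red: "reduces_to \<pi> (?c n) (\<rho> n)" if "n \<in> N" for n
  proof -
    \<comment> \<open>After reduction, conjugation by \<open>\<rho> g\<close> undoes the conjugation
      of \<open>n\<close> inside \<open>\<rho>\<close>, which leaves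
      \<open>\<rho> n\<close>.\<close>
    have "reduces_to \<pi> (?c n) (\<rho> g \<otimes>\<^bsub>Gam\<^esub> \<rho> (inv g \<otimes> n \<otimes> g) \<otimes>\<^bsub>Gam\<^esub> inv\<^bsub>Gam\<^esub> (\<rho> g))"
      using that g r by (auto simp: conj_lift_def \<sigma>D intro!: reduces_to_mult reduces_to_inv)
    then show ?thesis
      using that g by (simp add: rho_mult rho_inv Gam.m_assoc)
  qed
  show ?thesis
    using mult red g r(1) by (auto simp: lifts_def hom_def) (auto simp: conj_lift_def \<sigma>D)
qed

text \<open>
  With \<open>\<sigma>' = v \<sigma> v\<^sup>-\<^sup>1\<close> and \<open>\<tau> = r \<sigma>(g\<^sup>-\<^sup>1 \<cdot> g) r\<^sup>-\<^sup>1\<close>, the two conjugates differ by \<open>r' v r\<^sup>-\<^sup>1 \<tau>(n)\<^sup>-\<^sup>1\<close>,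
  whose reduction is \<open>\<rho>(n g) \<rho>(g)\<^sup>-\<^sup>1 \<rho>(n)\<^sup>-\<^sup>1 = 1\<close>.
\<close>

lemma conj_lift_equiv:
  assumes g: "g \<in> carrier G" and n: "n \<in> N"
    and r: "r \<in> carrier Gam" "reduces_to \<pi> r (\<rho> g)"
    and r': "r' \<in> carrier Gam" "reduces_to \<pi> r' (\<rho> (n \<otimes> g))"
    and equiv: "(\<sigma>, \<sigma>') \<in> lift_equiv \<pi> (G\<lparr>carrier := N\<rparr>) \<rho>"
  shows "(conj_lift G N g r \<sigma>, conj_lift G N (n \<otimes> g) r' \<sigma>') \<in> lift_equiv \<pi> (G\<lparr>carrier := N\<rparr>) \<rho>"
proof -
  obtain v where v: "v \<in> red_kernel \<pi>" "\<And>m. m \<in> N \<Longrightarrow> \<sigma>' m \<otimes>\<^bsub>Gam\<^esub> v = v \<otimes>\<^bsub>Gam\<^esub> \<sigma> m"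
    and \<sigma>: "\<sigma> \<in> lifts \<pi> (G\<lparr>carrier := N\<rparr>) \<rho>" "\<sigma>' \<in> lifts \<pi> (G\<lparr>carrier := N\<rparr>) \<rho>"
    using equiv by (auto simp: N.lift_equiv_iff)
  let ?t = "conj_lift G N g r \<sigma>" and ?t' = "conj_lift G N (n \<otimes> g) r' \<sigma>'"
  have t: "?t \<in> lifts \<pi> (G\<lparr>carrier := N\<rparr>) \<rho>" "?t' \<in> lifts \<pi> (G\<lparr>carrier := N\<rparr>) \<rho>"
    using g n r r' \<sigma> by (auto intro: conj_lift_in_lifts)
  note D [simp] = N.liftsD(2-4) [OF \<sigma>(1), simplified] N.liftsD(2-4) [OF \<sigma>(2), simplified]
    N.liftsD(2-4) [OF t(1), simplified] N.liftsD(2-4) [OF t(2), simplified]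
  have [simp]: "v \<in> carrier Gam" "reduces_to \<pi> v \<one>\<^bsub>Gam\<^esub>"
    using v(1) by (simp_all add: red_kernel_iff)
  let ?w = "r' \<otimes>\<^bsub>Gam\<^esub> v \<otimes>\<^bsub>Gam\<^esub> inv\<^bsub>Gam\<^esub> r \<otimes>\<^bsub>Gam\<^esub> ?t (inv n)"
  have w: "?w \<in> red_kernel \<pi>"
  proof -
    have "reduces_to \<pi> ?w (\<rho> (n \<otimes> g) \<otimes>\<^bsub>Gam\<^esub> \<one>\<^bsub>Gam\<^esub> \<otimes>\<^bsub>Gam\<^esub> inv\<^bsub>Gam\<^esub> (\<rho> g) \<otimes>\<^bsub>Gam\<^esub> \<rho> (inv n))"
      using g n r r' by (intro reduces_to_mult reduces_to_inv) auto
    also have "\<rho> (n \<otimes> g) \<otimes>\<^bsub>Gam\<^esub> \<one>\<^bsub>Gam\<^esub> \<otimes>\<^bsub>Gam\<^esub> inv\<^bsub>Gam\<^esub> (\<rho> g) \<otimes>\<^bsub>Gam\<^esub> \<rho> (inv n) = \<one>\<^bsub>Gam\<^esub>"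
      using g n by (simp add: rho_mult rho_inv Gam.m_assoc)
    finally show ?thesis
      using n r r' by (simp add: red_kernel_iff)
  qed
  have "?t' m \<otimes>\<^bsub>Gam\<^esub> ?w = ?w \<otimes>\<^bsub>Gam\<^esub> ?t m" if m: "m \<in> N" for m
  proof -
    \<comment> \<open>Both lifts end up being evaluated at \<open>h\<close>: it is the conjugate of
      \<open>m\<close> by \<open>n \<otimes> g\<close>, hence the conjugate by \<open>g\<close> of
      \<open>inv n \<otimes> m \<otimes> n\<close>.\<close>
    define h where "h = inv g \<otimes> (inv n \<otimes> m \<otimes> n) \<otimes> g"
    have h: "h \<in> N"
      unfolding h_def using g n m by (intro conj_mem) auto
    have th: "?t (inv n \<otimes> m \<otimes> n) = r \<otimes>\<^bsub>Gam\<^esub> \<sigma> h \<otimes>\<^bsub>Gam\<^esub> inv\<^bsub>Gam\<^esub> r"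
      using n m by (simp add: conj_lift_def h_def)
    have "inv (n \<otimes> g) \<otimes> m \<otimes> (n \<otimes> g) = h"
      using g n m by (simp add: h_def inv_mult_group m_assoc)
    then have "?t' m \<otimes>\<^bsub>Gam\<^esub> ?w = r' \<otimes>\<^bsub>Gam\<^esub> (\<sigma>' h \<otimes>\<^bsub>Gam\<^esub> v) \<otimes>\<^bsub>Gam\<^esub> inv\<^bsub>Gam\<^esub> r \<otimes>\<^bsub>Gam\<^esub> ?t (inv n)"
      using m h n r r' by (simp add: conj_lift_def [of G N "n \<otimes> g"] Gam.m_assoc)
    also have "\<dots> = r' \<otimes>\<^bsub>Gam\<^esub> v \<otimes>\<^bsub>Gam\<^esub> inv\<^bsub>Gam\<^esub> r \<otimes>\<^bsub>Gam\<^esub> (?t (inv n \<otimes> m \<otimes> n) \<otimes>\<^bsub>Gam\<^esub> ?t (inv n))"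
      using v(2) h n r r' by (simp add: th Gam.m_assoc)
    also have "?t (inv n \<otimes> m \<otimes> n) \<otimes>\<^bsub>Gam\<^esub> ?t (inv n) = ?t (inv n) \<otimes>\<^bsub>Gam\<^esub> ?t m"
    proof -
      have "?t (inv n \<otimes> m \<otimes> n) \<otimes>\<^bsub>Gam\<^esub> ?t (inv n) = ?t (inv n \<otimes> m \<otimes> n \<otimes> inv n)"
        by (rule N.liftsD(3) [OF t(1), simplified, symmetric]) (use n m in simp_all)
      also have "inv n \<otimes> m \<otimes> n \<otimes> inv n = inv n \<otimes> m"
        using n m by (simp add: m_assoc)
      finally show ?thesis
        using n m by simp
    qed
    finally show ?thesis
      using n m r r' by (simp add: Gam.m_assoc)
  qed
  then show ?thesis
    using t w by (auto simp: N.lift_equiv_iff)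
qed

section \<open>The action of the quotient on classes of lifts\<close>

abbreviation "G\<^sub>N \<equiv> G\<lparr>carrier := N\<rparr>"

text \<open>\<open>conj_lift_equiv\<close> settles independence of the coset representative, of the
  automorphism chosen over it and of the representing lift all at once.\<close>

lemma def_action_class:
  assumes g: "g \<in> carrier G" and r: "r \<in> carrier Gam" "reduces_to \<pi> r (\<rho> g)"
    and \<sigma>: "\<sigma> \<in> lifts \<pi> G\<^sub>N \<rho>"
  shows "def_action \<pi> G N \<rho> (N #> g) (lift_class \<pi> G\<^sub>N \<rho> \<sigma>) = lift_class \<pi> G\<^sub>N \<rho> (conj_lift G N g r \<sigma>)"
proof -
  have eq: "lift_class \<pi> G\<^sub>N \<rho> (conj_lift G N g' r' \<sigma>') = lift_class \<pi> G\<^sub>N \<rho> (conj_lift G N g r \<sigma>)"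
    if "g' \<in> N #> g" and r': "r' \<in> {r \<in> carrier Gam. reduces_to \<pi> r (\<rho> g')}"
      and \<sigma>': "\<sigma>' \<in> lift_class \<pi> G\<^sub>N \<rho> \<sigma>" for g' r' \<sigma>'
  proof -
    obtain n where "n \<in> N" "g' = n \<otimes> g"
      using \<open>g' \<in> N #> g\<close> by (auto simp: r_coset_def)
    then have "(conj_lift G N g r \<sigma>, conj_lift G N g' r' \<sigma>') \<in> lift_equiv \<pi> G\<^sub>N \<rho>"
      using conj_lift_equiv [OF g _ r] r' \<sigma>' by (simp add: lift_class_def)
    then show ?thesis
      by (subst eq_commute) (simp add: N.lift_class_eq_iff N.lift_equiv_iff)
  qed
  have inner: "(\<Union>\<sigma>'\<in>lift_class \<pi> G\<^sub>N \<rho> \<sigma>. lift_class \<pi> G\<^sub>N \<rho> (conj_lift G N g' r' \<sigma>')) =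
      lift_class \<pi> G\<^sub>N \<rho> (conj_lift G N g r \<sigma>)"
    if "g' \<in> N #> g" "r' \<in> {r \<in> carrier Gam. reduces_to \<pi> r (\<rho> g')}" for g' r'
    using eq [OF that] N.lift_class_self [OF \<sigma>] by (intro SUP_eq_const) blast+
  have g_mem: "g \<in> N #> g"
    using g by (rule rcos_self) (rule subgroup_axioms)
  \<comment> \<open>For other \<open>g'\<close> in the coset no automorphism over
    \<open>\<rho> g'\<close> is exhibited, so the union is bounded from both sides; the lower bound
    comes from the given \<open>g\<close> and \<open>r\<close>.\<close>
  have "def_action \<pi> G N \<rho> (N #> g) (lift_class \<pi> G\<^sub>N \<rho> \<sigma>) \<subseteq> lift_class \<pi> G\<^sub>N \<rho> (conj_lift G N g r \<sigma>)"
    unfolding def_action_def using inner by blast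
  moreover have "lift_class \<pi> G\<^sub>N \<rho> (conj_lift G N g r \<sigma>) \<subseteq> def_action \<pi> G N \<rho> (N #> g) (lift_class \<pi> G\<^sub>N \<rho> \<sigma>)"
    unfolding def_action_def using g_mem r N.lift_class_self [OF \<sigma>] by blast
  ultimately show ?thesis ..
qed

section \<open>The action on cocycles and its agreement with the action on lifts\<close>

lemma carrier_Mod_iff: "Q \<in> carrier (G Mod N) \<longleftrightarrow> (\<exists>g\<in>carrier G. Q = N #> g)"
  by (auto simp: FactGroup_def RCOSETS_def)

lemma cocycle_lift_conj_cocycle:
  assumes g: "g \<in> carrier G" and \<gamma>: "\<gamma> \<in> carrier (Z1 G\<^sub>N Der (der_act \<rho>))"
  shows "cocycle_lift G\<^sub>N \<rho> (conj_cocycle G N (der_act \<rho>) g \<gamma>) =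
    conj_lift G N g (base_change (\<rho> g)) (cocycle_lift G\<^sub>N \<rho> \<gamma>)"
proof
  fix n
  show "cocycle_lift G\<^sub>N \<rho> (conj_cocycle G N (der_act \<rho>) g \<gamma>) n =
    conj_lift G N g (base_change (\<rho> g)) (cocycle_lift G\<^sub>N \<rho> \<gamma>) n"
  proof (cases "n \<in> N")
    case n: True
    let ?n = "inv g \<otimes> n \<otimes> g" and ?s = "\<lambda>h. base_change (\<rho> h)"
    have m: "?n \<in> N"
      using g n by simp
    then have [simp]: "\<gamma> ?n \<in> carrier Der"
      using PiE_mem [OF N.Z1_funcset [OF \<gamma>]] by simp
    have [simp]: "?s g \<in> carrier Gam" "?s ?n \<in> carrier Gam" "?s n \<in> carrier Gam"
      using g n m by simp_all
    \<comment> \<open>This relation lets \<open>?s g\<close> pass to the right, where it cancels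
      against its inverse, and turns the base change at \<open>?n\<close> into the one at
      \<open>n\<close>.\<close>
    have "g \<otimes> ?n = n \<otimes> g"
      using g n by (simp add: m_assoc)
    then have s: "?s g \<otimes>\<^bsub>Gam\<^esub> ?s ?n = ?s n \<otimes>\<^bsub>Gam\<^esub> ?s g"
      using g n m by (simp flip: base_change_mult rho_mult)
    have "conj_lift G N g (?s g) (cocycle_lift G\<^sub>N \<rho> \<gamma>) n =
        ?s g \<otimes>\<^bsub>Gam\<^esub> (der_aut (\<gamma> ?n) \<otimes>\<^bsub>Gam\<^esub> ?s ?n) \<otimes>\<^bsub>Gam\<^esub> inv\<^bsub>Gam\<^esub> (?s g)"
      using n m by (simp add: conj_lift_def cocycle_lift_def)
    also have "\<dots> = (?s g \<otimes>\<^bsub>Gam\<^esub> der_aut (\<gamma> ?n)) \<otimes>\<^bsub>Gam\<^esub> ?s ?n \<otimes>\<^bsub>Gam\<^esub> inv\<^bsub>Gam\<^esub> (?s g)"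
      by (simp add: Gam.m_assoc)
    also have "\<dots> = der_aut (der_act \<rho> g (\<gamma> ?n)) \<otimes>\<^bsub>Gam\<^esub> (?s g \<otimes>\<^bsub>Gam\<^esub> ?s ?n) \<otimes>\<^bsub>Gam\<^esub> inv\<^bsub>Gam\<^esub> (?s g)"
      using g by (simp add: base_change_rho_der_aut Gam.m_assoc)
    also have "\<dots> = der_aut (der_act \<rho> g (\<gamma> ?n)) \<otimes>\<^bsub>Gam\<^esub> ?s n"
      unfolding s using g by (simp add: Gam.m_assoc)
    finally show ?thesis
      using n by (simp add: cocycle_lift_def conj_cocycle_def)
  qed (simp add: cocycle_lift_def conj_lift_def)
qed

text \<open>The associated lift is a conjugate of a lift, hence itself a lift, and the criterion for
  cocycles in terms of lifts applies.\<close>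

lemma conj_cocycle_closed:
  assumes g: "g \<in> carrier G" and \<gamma>: "\<gamma> \<in> carrier (Z1 G\<^sub>N Der (der_act \<rho>))"
  shows "conj_cocycle G N (der_act \<rho>) g \<gamma> \<in> carrier (Z1 G\<^sub>N Der (der_act \<rho>))"
proof -
  have "conj_cocycle G N (der_act \<rho>) g \<gamma> \<in> carrier G\<^sub>N \<rightarrow>\<^sub>E carrier Der"
    using g PiE_mem [OF N.Z1_funcset [OF \<gamma>]] by (auto simp: conj_cocycle_def)
  moreover have "cocycle_lift G\<^sub>N \<rho> (conj_cocycle G N (der_act \<rho>) g \<gamma>) \<in> lifts dual_red G\<^sub>N \<rho>"
    unfolding cocycle_lift_conj_cocycle [OF assms]
    using g \<gamma> by (intro conj_lift_in_lifts N.cocycle_lift_in_lifts) simp_all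
  ultimately show ?thesis
    using N.cocycle_lift_in_lifts_iff by blast
qed

text \<open>Independence of the choices is \<open>conj_lift_equiv\<close> for the automorphisms
  \<open>base_change (\<rho> g)\<close> and \<open>base_change (\<rho> g')\<close>, transported
  through \<open>H1_class_eq_iff\<close>.\<close>

lemma H1_action_class:
  assumes g: "g \<in> carrier G" and \<gamma>: "\<gamma> \<in> carrier (Z1 G\<^sub>N Der (der_act \<rho>))"
  shows "H1_action G N Der (der_act \<rho>) (N #> g) (H1_class G\<^sub>N Der (der_act \<rho>) \<gamma>) =
    H1_class G\<^sub>N Der (der_act \<rho>) (conj_cocycle G N (der_act \<rho>) g \<gamma>)"
proof -
  have eq: "H1_class G\<^sub>N Der (der_act \<rho>) (conj_cocycle G N (der_act \<rho>) g' \<gamma>') =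
      H1_class G\<^sub>N Der (der_act \<rho>) (conj_cocycle G N (der_act \<rho>) g \<gamma>)"
    if "g' \<in> N #> g" and "\<gamma>' \<in> H1_class G\<^sub>N Der (der_act \<rho>) \<gamma>" for g' \<gamma>'
  proof -
    obtain n where n: "n \<in> N" "g' = n \<otimes> g"
      using \<open>g' \<in> N #> g\<close> by (auto simp: r_coset_def)
    have g': "g' \<in> carrier G"
      using n g by simp
    have \<gamma>': "\<gamma>' \<in> carrier (Z1 G\<^sub>N Der (der_act \<rho>))"
      and equiv: "(cocycle_lift G\<^sub>N \<rho> \<gamma>, cocycle_lift G\<^sub>N \<rho> \<gamma>') \<in> lift_equiv dual_red G\<^sub>N \<rho>"
      using that \<gamma> by (simp_all add: N.H1_class_eq_vimage lift_class_def)
    have "(cocycle_lift G\<^sub>N \<rho> (conj_cocycle G N (der_act \<rho>) g \<gamma>),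
        cocycle_lift G\<^sub>N \<rho> (conj_cocycle G N (der_act \<rho>) g' \<gamma>')) \<in> lift_equiv dual_red G\<^sub>N \<rho>"
      unfolding cocycle_lift_conj_cocycle [OF g \<gamma>] cocycle_lift_conj_cocycle [OF g' \<gamma>']
      using g' unfolding n(2) by (intro conj_lift_equiv equiv g n) (use g in simp_all)
    then show ?thesis
      by (subst eq_commute)
         (simp add: N.H1_class_eq_iff conj_cocycle_closed g \<gamma> g' \<gamma>' N.lift_class_eq_iff N.cocycle_lift_in_lifts)
  qed
  have "g \<in> N #> g"
    using g by (rule rcos_self) (rule subgroup_axioms)
  moreover have "\<gamma> \<in> H1_class G\<^sub>N Der (der_act \<rho>) \<gamma>"
    using \<gamma> by (rule N.H1_class_self)
  ultimately show ?thesis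
    unfolding H1_action_def using eq by blast
qed

text \<open>Once the action on lifts is computed with \<open>base_change (\<rho> g)\<close>, both
  sides are the class of the same lift.\<close>

lemma def_action_tangent_of_H1:
  assumes "Q \<in> carrier (G Mod N)" "c \<in> carrier (H1 G\<^sub>N Der (der_act \<rho>))"
  shows "def_action dual_red G N \<rho> Q (tangent_of_H1 G\<^sub>N \<rho> c) =
    tangent_of_H1 G\<^sub>N \<rho> (H1_action G N Der (der_act \<rho>) Q c)"
proof -
  obtain g \<gamma> where "g \<in> carrier G" "Q = N #> g" "\<gamma> \<in> carrier (Z1 G\<^sub>N Der (der_act \<rho>))"
    "c = H1_class G\<^sub>N Der (der_act \<rho>) \<gamma>"
    using assms by (auto simp: carrier_Mod_iff carrier_H1)
  then show ?thesis
    by (simp add: N.tangent_of_H1_class H1_action_class conj_cocycle_closed cocycle_lift_conj_cocycle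
        def_action_class [of g "base_change (\<rho> g)"] N.cocycle_lift_in_lifts)
qed

section \<open>Invariants\<close>

lemma H1_action_closed:
  assumes "Q \<in> carrier (G Mod N)" "c \<in> carrier (H1 G\<^sub>N Der (der_act \<rho>))"
  shows "H1_action G N Der (der_act \<rho>) Q c \<in> carrier (H1 G\<^sub>N Der (der_act \<rho>))"
  using assms by (auto simp: carrier_Mod_iff carrier_H1 H1_action_class conj_cocycle_closed)

text \<open>Equivariance and injectivity of the identification match the two fixed-point conditions
  coset by coset; injectivity applies because the action stays within the cohomology group.\<close>

lemma tangent_of_H1_invariant_iff:
  assumes "c \<in> carrier (H1 G\<^sub>N Der (der_act \<rho>))"
  shows "tangent_of_H1 G\<^sub>N \<rho> c \<in> def_invariants dual_red G N \<rho> \<longleftrightarrow> c \<in> H1_invariants G N Der (der_act \<rho>)"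
proof -
  have inj: "inj_on (tangent_of_H1 G\<^sub>N \<rho>) (carrier (H1 G\<^sub>N Der (der_act \<rho>)))"
    and mem: "tangent_of_H1 G\<^sub>N \<rho> c \<in> tangent_space G\<^sub>N \<rho>"
    using N.bij_betw_tangent_of_H1 assms by (auto simp: bij_betw_def)
  have "def_action dual_red G N \<rho> Q (tangent_of_H1 G\<^sub>N \<rho> c) = tangent_of_H1 G\<^sub>N \<rho> c \<longleftrightarrow>
      H1_action G N Der (der_act \<rho>) Q c = c" if "Q \<in> carrier (G Mod N)" for Q
    using that assms H1_action_closed by (simp add: def_action_tangent_of_H1 inj_on_eq_iff [OF inj])
  then show ?thesis
    using assms mem by (simp add: def_invariants_def H1_invariants_def)
qed

lemma bij_betw_invariants:
  "bij_betw (tangent_of_H1 G\<^sub>N \<rho>) (H1_invariants G N Der (der_act \<rho>)) (def_invariants dual_red G N \<rho>)"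
proof (rule bij_betw_subset [OF N.bij_betw_tangent_of_H1])
  show sub: "H1_invariants G N Der (der_act \<rho>) \<subseteq> carrier (H1 G\<^sub>N Der (der_act \<rho>))"
    by (auto simp: H1_invariants_def)
  have "def_invariants dual_red G N \<rho> \<subseteq> tangent_of_H1 G\<^sub>N \<rho> ` carrier (H1 G\<^sub>N Der (der_act \<rho>))"
    using N.bij_betw_tangent_of_H1 by (auto simp: bij_betw_def def_invariants_def)
  then show "tangent_of_H1 G\<^sub>N \<rho> ` H1_invariants G N Der (der_act \<rho>) = def_invariants dual_red G N \<rho>"
    using sub tangent_of_H1_invariant_iff by blast
qed

section \<open>Restriction from \<open>G\<close> to \<open>N\<close>\<close>

lemma restrict_in_lifts:
  assumes "\<sigma> \<in> lifts \<pi> G \<rho>"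
  shows "restrict \<sigma> N \<in> lifts \<pi> G\<^sub>N \<rho>"
  using liftsD [OF assms] by (auto simp: lifts_def hom_def)

text \<open>The kernel element that conjugates the lifts on \<open>G\<close> also conjugates their
  restrictions.\<close>

lemma restrict_lift_equiv:
  assumes "(\<sigma>, \<sigma>') \<in> lift_equiv \<pi> G \<rho>"
  shows "(restrict \<sigma> N, restrict \<sigma>' N) \<in> lift_equiv \<pi> G\<^sub>N \<rho>"
  using assms by (auto simp: lift_equiv_def restrict_in_lifts)

lemma def_res_class:
  assumes "\<sigma> \<in> lifts \<pi> G \<rho>"
  shows "def_res \<pi> G N \<rho> (lift_class \<pi> G \<rho> \<sigma>) = lift_class \<pi> G\<^sub>N \<rho> (restrict \<sigma> N)"
proof -
  have "lift_class \<pi> G\<^sub>N \<rho> (restrict \<sigma>' N) = lift_class \<pi> G\<^sub>N \<rho> (restrict \<sigma> N)"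
    if "\<sigma>' \<in> lift_class \<pi> G \<rho> \<sigma>" for \<sigma>'
    using that restrict_lift_equiv [of \<sigma> \<sigma>' \<pi>]
    by (subst eq_commute) (simp add: lift_class_def [of \<pi> G] N.lift_class_eq_iff N.lift_equiv_iff)
  then show ?thesis
    unfolding def_res_def using lift_class_self [OF assms] by blast
qed

text \<open>A lift on all of \<open>G\<close> provides its own automorphism over
  \<open>\<rho> g\<close>, namely \<open>\<sigma> g\<close>. As \<open>\<sigma>\<close> is a
  homomorphism, conjugating with it gives back the restriction itself and not just an equivalent
  lift.\<close>

lemma def_res_invariant:
  assumes "X \<in> def_functor \<pi> G \<rho>"
  shows "def_res \<pi> G N \<rho> X \<in> def_invariants \<pi> G N \<rho>"
proof -
  obtain \<sigma> where \<sigma>: "\<sigma> \<in> lifts \<pi> G \<rho>" and X: "X = lift_class \<pi> G \<rho> \<sigma>"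
    using assms by (auto simp: def_functor_eq)
  have "def_action \<pi> G N \<rho> (N #> g) (lift_class \<pi> G\<^sub>N \<rho> (restrict \<sigma> N)) = lift_class \<pi> G\<^sub>N \<rho> (restrict \<sigma> N)"
    if g: "g \<in> carrier G" for g
  proof -
    have "conj_lift G N g (\<sigma> g) (restrict \<sigma> N) n = restrict \<sigma> N n" for n
    proof (cases "n \<in> N")
      case n: True
      then have "\<sigma> g \<otimes>\<^bsub>Gam\<^esub> \<sigma> (inv g \<otimes> n \<otimes> g) = \<sigma> (g \<otimes> (inv g \<otimes> n \<otimes> g))"
        using g \<sigma> by (intro liftsD(3) [symmetric]) auto
      also have "g \<otimes> (inv g \<otimes> n \<otimes> g) = n \<otimes> g"
        using g n by (simp add: m_assoc)
      finally show ?thesis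
        using g n \<sigma> by (simp add: conj_lift_def liftsD Gam.m_assoc)
    qed (simp add: conj_lift_def)
    then have "conj_lift G N g (\<sigma> g) (restrict \<sigma> N) = restrict \<sigma> N" ..
    then show ?thesis
      using def_action_class [of g "\<sigma> g" \<pi> "restrict \<sigma> N"] g \<sigma> by (simp add: liftsD restrict_in_lifts)
  qed
  then show ?thesis
    using \<sigma> by (auto simp: X def_res_class def_invariants_def carrier_Mod_iff N.def_functor_eq restrict_in_lifts)
qed

lemma cocycle_lift_restrict:
  "cocycle_lift G\<^sub>N \<rho> (restrict \<gamma> N) = restrict (cocycle_lift G \<rho> \<gamma>) N"
proof
  fix n
  show "cocycle_lift G\<^sub>N \<rho> (restrict \<gamma> N) n = restrict (cocycle_lift G \<rho> \<gamma>) N n"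
    by (cases "n \<in> N") (simp_all add: cocycle_lift_def)
qed

lemma restrict_Z1:
  assumes "\<gamma> \<in> carrier (Z1 G Der (der_act \<rho>))"
  shows "restrict \<gamma> N \<in> carrier (Z1 G\<^sub>N Der (der_act \<rho>))"
  using assms PiE_mem [OF Z1_funcset [OF assms]] by (auto simp: Z1_def)

text \<open>Cohomologous cocycles on \<open>G\<close> have equivalent lifts; these stay equivalent
  on \<open>N\<close>, so the restricted cocycles are cohomologous.\<close>

lemma H1_res_class:
  assumes \<gamma>: "\<gamma> \<in> carrier (Z1 G Der (der_act \<rho>))"
  shows "H1_res G N Der (der_act \<rho>) (H1_class G Der (der_act \<rho>) \<gamma>) =
    H1_class G\<^sub>N Der (der_act \<rho>) (restrict \<gamma> N)"
proof -
  have "H1_class G\<^sub>N Der (der_act \<rho>) (restrict \<gamma>' N) = H1_class G\<^sub>N Der (der_act \<rho>) (restrict \<gamma> N)"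
    if "\<gamma>' \<in> H1_class G Der (der_act \<rho>) \<gamma>" for \<gamma>'
  proof -
    have \<gamma>': "\<gamma>' \<in> carrier (Z1 G Der (der_act \<rho>))"
      and "(cocycle_lift G \<rho> \<gamma>, cocycle_lift G \<rho> \<gamma>') \<in> lift_equiv dual_red G \<rho>"
      using that \<gamma> by (simp_all add: H1_class_eq_vimage lift_class_def)
    then have "(restrict (cocycle_lift G \<rho> \<gamma>) N, restrict (cocycle_lift G \<rho> \<gamma>') N) \<in> lift_equiv dual_red G\<^sub>N \<rho>"
      by (intro restrict_lift_equiv)
    then show ?thesis
      using \<gamma> \<gamma>'
      by (subst eq_commute)
         (simp add: N.H1_class_eq_iff restrict_Z1 cocycle_lift_restrict N.lift_class_eq_iff N.lift_equiv_iff)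
  qed
  then show ?thesis
    unfolding H1_res_def using H1_class_self [OF \<gamma>] by blast
qed

lemma def_res_tangent_of_H1:
  assumes "c \<in> carrier (H1 G Der (der_act \<rho>))"
  shows "def_res dual_red G N \<rho> (tangent_of_H1 G \<rho> c) =
    tangent_of_H1 G\<^sub>N \<rho> (H1_res G N Der (der_act \<rho>) c)"
  using assms
  by (auto simp: carrier_H1 tangent_of_H1_class N.tangent_of_H1_class H1_res_class restrict_Z1
      def_res_class cocycle_lift_in_lifts cocycle_lift_restrict)

text \<open>Invariance is deduced from \<open>def_res_invariant\<close>: the two restrictions
  correspond under the identification, and the identification reflects invariance.\<close>

lemma H1_res_invariant:
  assumes c: "c \<in> carrier (H1 G Der (der_act \<rho>))"
  shows "H1_res G N Der (der_act \<rho>) c \<in> H1_invariants G N Der (der_act \<rho>)"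
proof -
  have "H1_res G N Der (der_act \<rho>) c \<in> carrier (H1 G\<^sub>N Der (der_act \<rho>))"
    using c by (auto simp: carrier_H1 H1_res_class restrict_Z1)
  moreover have "tangent_of_H1 G \<rho> c \<in> tangent_space G \<rho>"
    using bij_betw_tangent_of_H1 c by (auto simp: bij_betw_def)
  ultimately show ?thesis
    using def_res_invariant def_res_tangent_of_H1 [OF c] tangent_of_H1_invariant_iff by metis
qed

end

theorem proposition2p4:
  fixes G :: "('g, 'm) monoid_scheme"
    and N :: "'g set"
    and \<rho> :: "'g \<Rightarrow> 'k::field fps \<Rightarrow> 'k fps"
    and p :: nat
  assumes "p > 0" and "CHAR('k) = p" and "surj (\<lambda>x::'k. x ^ p)"
    and "group G" and "finite (carrier G)" and "local_action G \<rho>" and "N \<lhd> G"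
  shows
    "\<comment> \<open>the identifications of the tangent spaces with first cohomology groups\<close>
     (\<forall>\<gamma>\<in>carrier (Z1 G Der (der_act \<rho>)).
        cocycle_lift G \<rho> \<gamma> \<in> lifts dual_red G \<rho> \<and>
        tangent_of_H1 G \<rho> (H1_class G Der (der_act \<rho>) \<gamma>) = lift_class dual_red G \<rho> (cocycle_lift G \<rho> \<gamma>)) \<and>
     (\<forall>\<gamma>\<in>carrier (Z1 (G\<lparr>carrier := N\<rparr>) Der (der_act \<rho>)).
        cocycle_lift (G\<lparr>carrier := N\<rparr>) \<rho> \<gamma> \<in> lifts dual_red (G\<lparr>carrier := N\<rparr>) \<rho> \<and>
        tangent_of_H1 (G\<lparr>carrier := N\<rparr>) \<rho> (H1_class (G\<lparr>carrier := N\<rparr>) Der (der_act \<rho>) \<gamma>) =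
          lift_class dual_red (G\<lparr>carrier := N\<rparr>) \<rho> (cocycle_lift (G\<lparr>carrier := N\<rparr>) \<rho> \<gamma>)) \<and>
     bij_betw (tangent_of_H1 G \<rho>) (carrier (H1 G Der (der_act \<rho>))) (tangent_space G \<rho>) \<and>
     bij_betw (tangent_of_H1 (G\<lparr>carrier := N\<rparr>) \<rho>)
       (carrier (H1 (G\<lparr>carrier := N\<rparr>) Der (der_act \<rho>))) (tangent_space (G\<lparr>carrier := N\<rparr>) \<rho>) \<and>

     \<comment> \<open>the two actions of the quotient group, on classes of lifts and on classes of cocycles\<close>
     (\<forall>g\<in>carrier G. \<forall>r\<in>carrier Gam. \<forall>\<sigma>\<in>lifts dual_red (G\<lparr>carrier := N\<rparr>) \<rho>.
        reduces_to dual_red r (\<rho> g) \<longrightarrow>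
        conj_lift G N g r \<sigma> \<in> lifts dual_red (G\<lparr>carrier := N\<rparr>) \<rho> \<and>
        def_action dual_red G N \<rho> (N #>\<^bsub>G\<^esub> g) (lift_class dual_red (G\<lparr>carrier := N\<rparr>) \<rho> \<sigma>) =
          lift_class dual_red (G\<lparr>carrier := N\<rparr>) \<rho> (conj_lift G N g r \<sigma>)) \<and>
     (\<forall>g\<in>carrier G. \<forall>\<gamma>\<in>carrier (Z1 (G\<lparr>carrier := N\<rparr>) Der (der_act \<rho>)).
        conj_cocycle G N (der_act \<rho>) g \<gamma> \<in> carrier (Z1 (G\<lparr>carrier := N\<rparr>) Der (der_act \<rho>)) \<and>
        H1_action G N Der (der_act \<rho>) (N #>\<^bsub>G\<^esub> g) (H1_class (G\<lparr>carrier := N\<rparr>) Der (der_act \<rho>) \<gamma>) =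
          H1_class (G\<lparr>carrier := N\<rparr>) Der (der_act \<rho>) (conj_cocycle G N (der_act \<rho>) g \<gamma>)) \<and>

     \<comment> \<open>they correspond to each other\<close>
     (\<forall>Q\<in>carrier (G Mod N). \<forall>c\<in>carrier (H1 (G\<lparr>carrier := N\<rparr>) Der (der_act \<rho>)).
        def_action dual_red G N \<rho> Q (tangent_of_H1 (G\<lparr>carrier := N\<rparr>) \<rho> c) =
          tangent_of_H1 (G\<lparr>carrier := N\<rparr>) \<rho> (H1_action G N Der (der_act \<rho>) Q c)) \<and>
     bij_betw (tangent_of_H1 (G\<lparr>carrier := N\<rparr>) \<rho>)
       (H1_invariants G N Der (der_act \<rho>)) (def_invariants dual_red G N \<rho>) \<and>

     \<comment> \<open>the two restriction maps\<close>
     (\<forall>\<sigma>\<in>lifts dual_red G \<rho>.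
        restrict \<sigma> N \<in> lifts dual_red (G\<lparr>carrier := N\<rparr>) \<rho> \<and>
        def_res dual_red G N \<rho> (lift_class dual_red G \<rho> \<sigma>) =
          lift_class dual_red (G\<lparr>carrier := N\<rparr>) \<rho> (restrict \<sigma> N)) \<and>
     (\<forall>\<gamma>\<in>carrier (Z1 G Der (der_act \<rho>)).
        restrict \<gamma> N \<in> carrier (Z1 (G\<lparr>carrier := N\<rparr>) Der (der_act \<rho>)) \<and>
        H1_res G N Der (der_act \<rho>) (H1_class G Der (der_act \<rho>) \<gamma>) =
          H1_class (G\<lparr>carrier := N\<rparr>) Der (der_act \<rho>) (restrict \<gamma> N)) \<and>
     def_res dual_red G N \<rho> \<in> tangent_space G \<rho> \<rightarrow> def_invariants dual_red G N \<rho> \<and>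
     H1_res G N Der (der_act \<rho>) \<in> carrier (H1 G Der (der_act \<rho>)) \<rightarrow> H1_invariants G N Der (der_act \<rho>) \<and>

     \<comment> \<open>they correspond to each other\<close>
     (\<forall>c\<in>carrier (H1 G Der (der_act \<rho>)).
        def_res dual_red G N \<rho> (tangent_of_H1 G \<rho> c) =
          tangent_of_H1 (G\<lparr>carrier := N\<rparr>) \<rho> (H1_res G N Der (der_act \<rho>) c))"
proof -
  interpret normal_aut_action G N \<rho>
    using assms by (simp add: normal_aut_action_def aut_action_def aut_action_axioms_def local_action_def)
  show ?thesis
    by (intro conjI ballI impI Pi_I)
       (simp_all add: tangent_of_H1_class N.tangent_of_H1_class cocycle_lift_in_lifts N.cocycle_lift_in_lifts
          bij_betw_tangent_of_H1 N.bij_betw_tangent_of_H1 conj_lift_in_lifts def_action_class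
          conj_cocycle_closed H1_action_class def_action_tangent_of_H1 bij_betw_invariants
          restrict_in_lifts def_res_class restrict_Z1 H1_res_class def_res_invariant H1_res_invariant
          def_res_tangent_of_H1)
qed

end
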